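(* Let $S=\langle g_1,g_2,g_3\rangle$ be a $3$-generated numerical semigroup with $g_1<g_2<g_3$ and let $R=K[[t^S]]$ with maximal ideal $\mathbf m$. If $G(\mathbf m)$ is Buchsbaum and not Cohen-Macaulay, then $(0:_{G(\mathbf m)}\mathcal M^r)=G(\mathbf m)\,\overline{t^{kg_3}}$, where $$k=\min\{j\in\mathbb N\ :\ g_2\text{ divides }(j+1)g_3\ \text{ or }\ (j+1)g_3-g_1\in S\}.$$
   Context: $K$ is an infinite field, and $\mathbb N$ includes $0$. $S\subseteq\mathbb N$ is the numerical semigroup with minimal generators $g_1<g_2<g_3$, $\gcd(g_1,g_2,g_3)=1$. $R=K[[t^S]]=K[[t^{g_1},t^{g_2},t^{g_3}]]$, $\mathbf m=(t^{g_1},t^{g_2},t^{g_3})$, $G(\mathbf m)=\bigoplus_{i\ge0}\mathbf m^i/\mathbf m^{i+1}$, $\mathcal M$ is the homogeneous maximal ideal of $G(\mathbf m)$, and $r$ is the reduction number of $\mathbf m$, i.e. the least $r\ge 0$ with $\mathbf m^{r+1}=t^{g_1}\mathbf m^r$. $G(\mathbf m)$ is called Buchsbaum if $\mathcal M\cdot H^0_{\mathcal M}=0$, where $H^0_{\mathcal M}=\bigcup_{k\ge1}(0:_{G(\mathbf m)}\mathcal M^k)$, which equals $(0:_{G(\mathbf m)}\mathcal M^r)$. Let $M=S\setminus\{0\}$, $hM=M+\dots+M$ ($h$ summands), $0M=S$. For $s\in S$ with $s\in hM\setminus(h+1)M$, $\overline{t^s}$ denotes the (nonzero) class of $t^s$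 in $\mathbf m^h/\mathbf m^{h+1}\subset G(\mathbf m)$. *)

theory Defs
  imports
    "HOL-Computational_Algebra.Formal_Power_Series"
    "HOL-Library.Extended_Nat"
    "HOL-Algebra.QuotRing"
    "HOL-Algebra.Ideal_Product"
begin

section \<open>Numerical semigroups\<close>

inductive_set nsgen :: "nat set \<Rightarrow> nat set" for A where
  zero: "0 \<in> nsgen A"
| add: "s \<in> nsgen A \<Longrightarrow> a \<in> A \<Longrightarrow> s + a \<in> nsgen A"

definition minimal_generators :: "nat set \<Rightarrow> nat set \<Rightarrow> bool" where
  "minimal_generators S A \<longleftrightarrow> nsgen A = S \<and> (\<forall>B. B \<subset> A \<longrightarrow> nsgen B \<noteq> S)"

text \<open>\<open>nfoldM S h\<close> is $hM = M + \dots + M$ with $M = S \setminus \{0\}$ and the convention $0M = S$;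
  for a semigroup $S$ the case $h = 1$ is $S + M = M$, as it should be.\<close>

primrec nfoldM :: "nat set \<Rightarrow> nat \<Rightarrow> nat set" where
  "nfoldM S 0 = S"
| "nfoldM S (Suc h) = {a + b | a b. a \<in> nfoldM S h \<and> b \<in> S - {0}}"

text \<open>$K[[t^S]]$ as the subring of $K[[t]]$ of the series with support in $S$; $t^s$ is
  \<open>fps_X ^ s\<close>.\<close>

definition semigroup_ring :: "nat set \<Rightarrow> ('k::field) fps ring" where
  "semigroup_ring S = \<lparr>carrier = {f. \<forall>n. fps_nth f n \<noteq> 0 \<longrightarrow> n \<in> S},
     monoid.mult = (*), one = 1, zero = 0, add = (+)\<rparr>"


section \<open>Ideals\<close>

abbreviation ideal_pow :: "('a, 'b) ring_scheme \<Rightarrow> 'a set \<Rightarrow> nat \<Rightarrow> 'a set" where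
  "ideal_pow R I n \<equiv> I [^]\<^bsub>ideals_set R\<^esub> n"

text \<open>The annihilator $(0 :_R J)$.\<close>

definition ann :: "('a, 'b) ring_scheme \<Rightarrow> 'a set \<Rightarrow> 'a set" where
  "ann R J = {x \<in> carrier R. \<forall>y \<in> J. x \<otimes>\<^bsub>R\<^esub> y = \<zero>\<^bsub>R\<^esub>}"

definition reduction_number :: "('a, 'b) ring_scheme \<Rightarrow> 'a set \<Rightarrow> 'a \<Rightarrow> nat" where
  "reduction_number R I x = (LEAST r. ideal_pow R I (r + 1) = x <#\<^bsub>R\<^esub> ideal_pow R I r)"


section \<open>The associated graded ring\<close>

text \<open>An element of $\bigoplus_{i \ge 0} I^i/I^{i+1}$ is a family of cosets \<open>F i\<close> of $I^{i+1}$ with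
  representatives in $I^i$, all but finitely many of them zero (that is, equal to $I^{i+1}$).
  In the product, the classes of $a \in I^i$ and $b \in I^{n-i}$ multiply to the class of $ab$ in
  $I^n/I^{n+1} \subseteq R/I^{n+1}$, and the sum over $i$ is taken in $R/I^{n+1}$.\<close>

definition assoc_graded :: "('a, 'b) ring_scheme \<Rightarrow> 'a set \<Rightarrow> (nat \<Rightarrow> 'a set) ring" where
  "assoc_graded R I =
    \<lparr>carrier = {F. (\<forall>i. \<exists>a \<in> ideal_pow R I i. F i = ideal_pow R I (i + 1) +>\<^bsub>R\<^esub> a) \<and>
                   finite {i. F i \<noteq> ideal_pow R I (i + 1)}},
     monoid.mult = (\<lambda>F G n. \<Oplus>\<^bsub>R Quot ideal_pow R I (n + 1)\<^esub> i \<in> {..n}.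
                       rcoset_mult R (ideal_pow R I (n + 1)) (F i) (G (n - i))),
     one = (\<lambda>i. if i = 0 then ideal_pow R I 1 +>\<^bsub>R\<^esub> \<one>\<^bsub>R\<^esub> else ideal_pow R I (i + 1)),
     zero = (\<lambda>i. ideal_pow R I (i + 1)),
     add = (\<lambda>F G i. F i <+>\<^bsub>R\<^esub> G i)\<rparr>"

text \<open>The ideal $\bigoplus_{i \ge 1} I^i/I^{i+1}$. When \<open>I\<close> is a maximal ideal, the degree 0 part is a
  field and this is the homogeneous maximal ideal.\<close>

definition graded_max_ideal :: "('a, 'b) ring_scheme \<Rightarrow> 'a set \<Rightarrow> (nat \<Rightarrow> 'a set) set" where
  "graded_max_ideal R I = {F \<in> carrier (assoc_graded R I). F 0 = \<zero>\<^bsub>assoc_graded R I\<^esub> 0}"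

text \<open>The class of $t^s$ in $I^h/I^{h+1}$, where $s \in hM \setminus (h+1)M$, as an element of the
  associated graded ring.\<close>

definition monomial_class ::
    "('k::field) fps ring \<Rightarrow> 'k fps set \<Rightarrow> nat set \<Rightarrow> nat \<Rightarrow> nat \<Rightarrow> 'k fps set" where
  "monomial_class R I S s =
    (let h = (THE h. s \<in> nfoldM S h - nfoldM S (h + 1))
     in (\<lambda>i. if i = h then ideal_pow R I (h + 1) +>\<^bsub>R\<^esub> fps_X ^ s
             else ideal_pow R I (i + 1)))"


section \<open>Buchsbaum and Cohen-Macaulay rings\<close>

definition loc_cohom0 :: "('a, 'b) ring_scheme \<Rightarrow> 'a set \<Rightarrow> 'a set" where
  "loc_cohom0 G J = (\<Union>k \<in> {1..}. ann G (ideal_pow G J k))"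

definition buchsbaum :: "('a, 'b) ring_scheme \<Rightarrow> 'a set \<Rightarrow> bool" where
  "buchsbaum G J \<longleftrightarrow> ideal_prod G J (loc_cohom0 G J) = {\<zero>\<^bsub>G\<^esub>}"

definition regular_sequence :: "('a, 'b) ring_scheme \<Rightarrow> 'a list \<Rightarrow> bool" where
  "regular_sequence G xs \<longleftrightarrow> set xs \<subseteq> carrier G \<and>
     (\<forall>i < length xs. \<forall>a \<in> carrier G.
        xs ! i \<otimes>\<^bsub>G\<^esub> a \<in> genideal G (set (take i xs)) \<longrightarrow> a \<in> genideal G (set (take i xs))) \<and>
     genideal G (set xs) \<noteq> carrier G"

definition depth :: "('a, 'b) ring_scheme \<Rightarrow> 'a set \<Rightarrow> enat" where
  "depth G J = (SUP xs \<in> {xs. regular_sequence G xs \<and> set xs \<subseteq> J}. enat (length xs))"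

definition height :: "('a, 'b) ring_scheme \<Rightarrow> 'a set \<Rightarrow> enat" where
  "height G P = (SUP n \<in> {n. \<exists>C. C n = P \<and> (\<forall>i \<le> n. primeideal (C i) G) \<and>
                                 (\<forall>i < n. C i \<subset> C (i + 1))}. enat n)"

text \<open>For a Noetherian ring \<open>G\<close>; for a maximal ideal \<open>P\<close>, the numbers \<open>depth G P\<close> and
  \<open>height G P\<close> are the depth and the dimension of the local ring $G_P$. The associated
  graded ring of a Noetherian ring is Noetherian.\<close>

definition cohen_macaulay :: "('a, 'b) ring_scheme \<Rightarrow> bool" where
  "cohen_macaulay G \<longleftrightarrow> (\<forall>P. maximalideal P G \<longrightarrow> depth G P = height G P)"

end

theory Submission
  imports Defs "HOL-Computational_Algebra.Polynomial"
begin

text \<open>The ideal $\mathbf m^h$ consists of the series supported on the $s \in S$ of order at least $h$,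
  where the order of $s$ is the largest number of generators that sum to $s$. So the associated
  graded ring $G$ has the classes of the $t^s$ as a basis, and the product of the classes of $t^u$ and
  $t^v$ is the class of $t^{u+v}$ if orders add, and 0 otherwise. Let $x$ be the class of $t^{g_1}$.
  The classes of $t^{g_2}$ and $t^{g_3}$ are nilpotent, hence $G$ retracts onto $K[x]$ with a nil
  kernel. If $x$ is regular then so is every nonzero element of $K[x]$, and $G$ is Cohen-Macaulay.
  Otherwise some class of $t^s$ is killed by a power of $x$, hence lies in $H^0$, and when $G$ is
  Buchsbaum it is killed by $\mathcal M$. Compare a longest expression
  $s = a g_1 + b g_2 + c g_3$ with a longest one of $s + g_1$, which is $b' g_2 + c' g_3$: already
  $c g_3$ is killed by $x^{a+1}$, so it is killed by $\mathcal M$, which forces $a = b = 0$. Two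
  different multiples of $g_3$ cannot both occur, and the one that does is determined by
  $z\,\overline{t^{c g_3}} = 0$ for the class $z$ of $t^{g_3}$.\<close>

section \<open>Rings with a nil retraction onto a polynomial ring\<close>

text \<open>\<open>cohen_macaulay\<close> ranges over all maximal ideals of G, including those that
  are not homogeneous. The retraction handles all of them together: every prime of G is pulled back
  from the principal ideal domain K[x], so that height and depth are both 1 at each maximal ideal.
  The ring axioms for G are not derived from its construction; they come from the assumption that G
  is not Cohen-Macaulay, which supplies a maximal ideal and with it a ring. All finiteness rests on
  one exchange: g1 copies of a generator g have the same sum as g copies of g1. Hence g2 and g3
  occur fewer than g1 times each in a longest expression, which bounds the defect, makes torsion
  classes vanish against high powers of the maximal ideal, and shows that the reduction number
  exists. Torsion alone does not single out a multiple of g3; the Buchsbaum condition has to be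
  applied again to each smaller torsion subexpression.\<close>

lemma poly_ideal_principal:
  fixes I :: "'k::field poly set"
  assumes zero: "0 \<in> I" and add: "\<And>p q. p \<in> I \<Longrightarrow> q \<in> I \<Longrightarrow> p + q \<in> I"
    and mult: "\<And>p q. p \<in> I \<Longrightarrow> q * p \<in> I"
  obtains d where "\<And>q. q \<in> I \<longleftrightarrow> d dvd q"
proof (cases "\<exists>p. p \<in> I \<and> p \<noteq> 0")
  case False
  then show ?thesis using that[of 0] zero by auto
next
  case True
  then obtain d where d: "d \<in> I" "d \<noteq> 0"
    and least: "\<And>q. q \<in> I \<Longrightarrow> q \<noteq> 0 \<Longrightarrow> degree d \<le> degree q"
    using ex_has_least_nat[of "\<lambda>p. p \<in> I \<and> p \<noteq> 0" _ degree] by metis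
  show ?thesis
  proof (rule that[of d])
    fix q
    show "q \<in> I \<longleftrightarrow> d dvd q"
    proof
      assume "q \<in> I"
      have "q mod d = q + (- (q div d)) * d"
        using div_mult_mod_eq[of q d] by (simp add: algebra_simps)
      then have "q mod d \<in> I" using add[OF \<open>q \<in> I\<close> mult[OF d(1)]] by metis
      then have "q mod d = 0"
        using least[of "q mod d"] degree_mod_less[OF d(2), of q] by linarith
      then show "d dvd q" by auto
    next
      assume "d dvd q"
      then obtain e where "q = d * e" ..
      then show "q \<in> I" using mult[OF d(1), of e] by (simp add: mult.commute)
    qed
  qed
qed

text \<open>A nonunit that divides a nonzero polynomial has positive degree, so dividing by it
  lowers the degree and must stop.\<close>

lemma poly_extract_power:
  fixes \<pi> p :: "'k::field poly"
  assumes "\<not> \<pi> dvd 1" "p \<noteq> 0"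
  obtains a u where "p = \<pi> ^ a * u" "\<not> \<pi> dvd u"
proof -
  have "\<exists>a u. p = \<pi> ^ a * u \<and> \<not> \<pi> dvd u"
    using assms(2)
  proof (induction "degree p" arbitrary: p rule: less_induct)
    case less
    show ?case
    proof (cases "\<pi> dvd p")
      case False
      then show ?thesis by (intro exI[of _ 0] exI[of _ p]) simp
    next
      case True
      then obtain q where q: "p = \<pi> * q" ..
      have nz: "\<pi> \<noteq> 0" "q \<noteq> 0" using q less.prems by auto
      have "degree \<pi> \<noteq> 0"
        using assms(1) nz(1) by (metis is_unit_iff_degree)
      then have "degree q < degree p" using q nz by (simp add: degree_mult_eq)
      then obtain a u where "q = \<pi> ^ a * u" "\<not> \<pi> dvd u" using less.hyps nz(2) by blast
      then show ?thesis using q by (intro exI[of _ "Suc a"] exI[of _ u]) simp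
    qed
  qed
  then show ?thesis using that by blast
qed

text \<open>\<phi> is the retraction and \<psi> its section. The values of \<phi> at one and zero
  follow from the section and from additivity. The assumption \<open>psi_regular\<close> is where
  regularity of x enters.\<close>

locale nil_retract = cring G for G (structure) +
  fixes \<phi> :: "'a \<Rightarrow> 'k::field poly" and \<psi> :: "'k poly \<Rightarrow> 'a"
  assumes phi_add: "a \<in> carrier G \<Longrightarrow> b \<in> carrier G \<Longrightarrow> \<phi> (a \<oplus> b) = \<phi> a + \<phi> b"
    and phi_mult: "a \<in> carrier G \<Longrightarrow> b \<in> carrier G \<Longrightarrow> \<phi> (a \<otimes> b) = \<phi> a * \<phi> b"
    and psi_closed: "\<psi> p \<in> carrier G"
    and psi_add: "\<psi> (p + q) = \<psi> p \<oplus> \<psi> q"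
    and psi_mult: "\<psi> (p * q) = \<psi> p \<otimes> \<psi> q"
    and psi_one: "\<psi> 1 = \<one>"
    and phi_psi: "\<phi> (\<psi> p) = p"
    and nil: "a \<in> carrier G \<Longrightarrow> \<phi> a = 0 \<Longrightarrow> \<exists>n::nat. a [^] n = \<zero>"
    and psi_regular: "p \<noteq> 0 \<Longrightarrow> a \<in> carrier G \<Longrightarrow> \<psi> p \<otimes> a = \<zero> \<Longrightarrow> a = \<zero>"
begin

lemma phi_one: "\<phi> \<one> = 1"
  using phi_psi[of 1] psi_one by simp

lemma phi_zero: "\<phi> \<zero> = 0"
  using phi_add[of \<zero> \<zero>] by (metis add_cancel_right_right l_zero zero_closed)

lemma psi_zero: "\<psi> 0 = \<zero>"
  using psi_add[of 0 0] psi_closed[of 0] by (metis add.r_cancel_one' add_0)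

lemma psi_power: "\<psi> (p ^ n) = \<psi> p [^] n"
  by (induction n) (simp_all add: psi_one psi_mult power_Suc2 del: power_Suc)

lemma decompose:
  assumes a: "a \<in> carrier G"
  obtains n where "n \<in> carrier G" "\<phi> n = 0" "a = \<psi> (\<phi> a) \<oplus> n"
proof -
  let ?n = "a \<ominus> \<psi> (\<phi> a)"
  have n: "?n \<in> carrier G" using a psi_closed by simp
  have e: "a = \<psi> (\<phi> a) \<oplus> ?n" using a psi_closed[of "\<phi> a"] by algebra
  have "\<phi> a = \<phi> a + \<phi> ?n"
    using arg_cong[OF e, of \<phi>] phi_add[OF psi_closed n] by (simp add: phi_psi)
  then show ?thesis using that n e by simp
qed

section \<open>Prime ideals of G as preimages of prime ideals of K[x]\<close>

lemma nil_in_prime: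
  assumes "primeideal Q G" "a \<in> carrier G" "\<phi> a = 0"
  shows "a \<in> Q"
proof -
  interpret Q: primeideal Q G by fact
  obtain n :: nat where "a [^] n = \<zero>" using nil assms by blast
  then have "a [^] n \<in> Q" using Q.zero_closed by simp
  then show ?thesis
  proof (induction n)
    case 0
    then show ?case using Q.one_imp_carrier Q.I_notcarr by simp
  next
    case (Suc n)
    then show ?case using Q.I_prime[of "a [^] n" a] assms(2) by auto
  qed
qed

text \<open>The elements \<open>a\<close> and \<open>\<psi> (\<phi> a)\<close> differ by a
  nilpotent, which every prime contains.\<close>

lemma prime_iff_psi:
  assumes Q: "primeideal Q G" and a: "a \<in> carrier G"
  shows "a \<in> Q \<longleftrightarrow> \<psi> (\<phi> a) \<in> Q"
proof -
  interpret Q: primeideal Q G by fact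
  obtain n where n: "n \<in> carrier G" "\<phi> n = 0" "a = \<psi> (\<phi> a) \<oplus> n" using decompose[OF a] .
  have nQ: "n \<in> Q" using nil_in_prime[OF Q n(1,2)] .
  show ?thesis
  proof
    assume "a \<in> Q"
    moreover have "\<psi> (\<phi> a) = a \<ominus> n" using n a psi_closed[of "\<phi> a"]
      by (metis add.m_comm add.inv_solve_right' minus_eq)
    ultimately show "\<psi> (\<phi> a) \<in> Q" using nQ by (simp add: minus_eq)
  next
    assume "\<psi> (\<phi> a) \<in> Q"
    then show "a \<in> Q" using nQ n(3) by (metis Q.a_closed)
  qed
qed

text \<open>The polynomials p with \<open>\<psi> p\<close> in Q form an ideal of K[x]; d is its
  generator and inherits primality from Q. The value d = 0 is possible and belongs to the kernel of
  \<phi>.\<close>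

lemma prime_generator:
  assumes "primeideal Q G"
  obtains d where "\<And>a. a \<in> carrier G \<Longrightarrow> a \<in> Q \<longleftrightarrow> d dvd \<phi> a"
    and "\<not> d dvd 1" and "\<And>p q. d dvd p * q \<Longrightarrow> d dvd p \<or> d dvd q"
proof -
  interpret Q: primeideal Q G by fact
  obtain d where d: "\<And>q. q \<in> {q. \<psi> q \<in> Q} \<longleftrightarrow> d dvd q"
  proof (rule poly_ideal_principal[of "{q. \<psi> q \<in> Q}"])
    show "0 \<in> {q. \<psi> q \<in> Q}" using psi_zero by simp
  qed (auto simp: psi_add psi_mult intro: Q.I_l_closed psi_closed)
  show ?thesis
  proof (rule that[of d])
    show "a \<in> Q \<longleftrightarrow> d dvd \<phi> a" if "a \<in> carrier G" for a
      using prime_iff_psi[OF assms that] d by simp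
    show "\<not> d dvd 1"
      using d[of 1] psi_one Q.one_imp_carrier Q.I_notcarr by auto
    show "d dvd p \<or> d dvd q" if "d dvd p * q" for p q
    proof -
      have "\<psi> p \<otimes> \<psi> q \<in> Q" using that d[of "p * q"] psi_mult by simp
      then have "\<psi> p \<in> Q \<or> \<psi> q \<in> Q" by (rule Q.I_prime[OF psi_closed psi_closed])
      then show ?thesis using d[of p] d[of q] by simp
    qed
  qed
qed

lemma preimage_multiples_ideal: "ideal {a \<in> carrier G. d dvd \<phi> a} G"
proof (rule idealI)
  show "ring G" by (rule ring_axioms)
  show "subgroup {a \<in> carrier G. d dvd \<phi> a} (add_monoid G)"
  proof (unfold_locales, goal_cases)
    case (4 a)
    then have a: "a \<in> carrier G" "d dvd \<phi> a" by auto
    have "\<phi> a + \<phi> (\<ominus> a) = 0" using phi_add[of a "\<ominus> a"] a phi_zero by (simp add: r_neg)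
    then have "\<phi> (\<ominus> a) = - \<phi> a" by (simp add: eq_neg_iff_add_eq_0 add.commute)
    then show ?case using a by (simp add: a_inv_def[symmetric])
  qed (auto simp: phi_add phi_zero)
qed (auto simp: phi_mult)

text \<open>The quotient is the domain K[x]. As every prime contains the kernel, this is the
  smallest prime, the bottom of the chain that realizes height 1.\<close>

lemma kernel_prime: "primeideal {a \<in> carrier G. \<phi> a = 0} G"
proof (rule primeidealI)
  show "ideal {a \<in> carrier G. \<phi> a = 0} G" using preimage_multiples_ideal[of 0] by simp
  show "cring G" by (rule is_cring)
  show "carrier G \<noteq> {a \<in> carrier G. \<phi> a = 0}" using phi_one one_closed by force
qed (auto simp: phi_mult)

lemma maximal_generator:
  assumes "maximalideal P G"
  obtains d where "\<And>a. a \<in> carrier G \<Longrightarrow> a \<in> P \<longleftrightarrow> d dvd \<phi> a"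
    and "\<not> d dvd 1" and "\<And>p q. d dvd p * q \<Longrightarrow> d dvd p \<or> d dvd q" and "d \<noteq> 0"
proof -
  interpret P: maximalideal P G by fact
  have "primeideal P G" by (rule maximalideal_prime[OF assms])
  then obtain d where d: "\<And>a. a \<in> carrier G \<Longrightarrow> a \<in> P \<longleftrightarrow> d dvd \<phi> a"
    "\<not> d dvd 1" "\<And>p q. d dvd p * q \<Longrightarrow> d dvd p \<or> d dvd q"
    using prime_generator by metis
  have "d \<noteq> 0"
  proof
    assume d0: "d = 0"
    \<comment> \<open>With d = 0, P would be the kernel of \<phi>, and the preimage of the ideal
      generated by X lies strictly between it and G.\<close>
    let ?J = "{a \<in> carrier G. [:0, 1:] dvd \<phi> a}"
    have "\<phi> a = 0" if "a \<in> P" for a using d(1)[OF P.Icarr] that d0 by simp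
    then have "P \<subseteq> ?J" using P.Icarr by auto
    then have "?J = P \<or> ?J = carrier G" using P.I_maximal[OF preimage_multiples_ideal] by auto
    moreover have "\<psi> [:0, 1:] \<in> ?J" "\<psi> [:0, 1:] \<notin> P"
      using psi_closed d(1) d0 by (auto simp: phi_psi)
    moreover have "\<one> \<notin> ?J" by (simp add: phi_one is_unit_pCons_iff)
    ultimately show False using one_closed by blast
  qed
  with d that show ?thesis by blast
qed

section \<open>Height of a maximal ideal\<close>

lemma height_maximal:
  assumes "maximalideal P G"
  shows "height G P = 1"
proof -
  interpret P: maximalideal P G by fact
  have Pp: "primeideal P G" by (rule maximalideal_prime[OF assms])
  obtain d where d: "\<And>a. a \<in> carrier G \<Longrightarrow> a \<in> P \<longleftrightarrow> d dvd \<phi> a" "d \<noteq> 0"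
    using maximal_generator[OF assms] by metis
  let ?N = "{a \<in> carrier G. \<phi> a = 0}"
  have "?N \<subset> P"
  proof
    show "?N \<subseteq> P" using d(1) by auto
    have "\<psi> d \<in> P" "\<psi> d \<notin> ?N" using d psi_closed by (auto simp: phi_psi)
    then show "?N \<noteq> P" by blast
  qed
  then have one: "\<exists>C. C (1::nat) = P \<and> (\<forall>i\<le>1. primeideal (C i) G) \<and> (\<forall>i<1. C i \<subset> C (i + 1))"
    using Pp kernel_prime by (intro exI[of _ "\<lambda>i. if i = 0 then ?N else P"]) auto
  have bound: "n \<le> 1" if C: "C n = P" "\<forall>i\<le>n. primeideal (C i) G" "\<forall>i<n. C i \<subset> C (i + 1)"
    for n and C :: "nat \<Rightarrow> 'a set"
  proof (rule ccontr)
    assume "\<not> n \<le> 1"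
    then have n: "0 < n" "1 < n" "0 \<le> n" "1 \<le> n" "2 \<le> n" by auto
    have pr: "primeideal (C 0) G" "primeideal (C 1) G" "primeideal (C 2) G"
      using C(2) n by blast+
    have sub: "C 0 \<subset> C 1" "C 1 \<subset> C 2"
      using C(3) n by (auto simp: numeral_2_eq_2)
    interpret C1: primeideal "C 1" G by fact
    interpret C2: primeideal "C 2" G by fact
    \<comment> \<open>\<open>C 1\<close> contains an element outside \<open>C 0\<close>, so d1 is
      nonzero. Since d1 is prime and d2 divides it, either d1 divides d2, which collapses
      \<open>C 2\<close> to \<open>C 1\<close>, or d2 is a unit.\<close>
    obtain d1 where d1: "\<And>a. a \<in> carrier G \<Longrightarrow> a \<in> C 1 \<longleftrightarrow> d1 dvd \<phi> a"
      "\<And>p q. d1 dvd p * q \<Longrightarrow> d1 dvd p \<or> d1 dvd q"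
      using prime_generator[OF pr(2)] by metis
    obtain d2 where d2: "\<And>a. a \<in> carrier G \<Longrightarrow> a \<in> C 2 \<longleftrightarrow> d2 dvd \<phi> a" "\<not> d2 dvd 1"
      using prime_generator[OF pr(3)] by metis
    obtain a where a: "a \<in> C 1" "a \<notin> C 0" using sub by blast
    have "\<phi> a \<noteq> 0" using nil_in_prime[OF pr(1)] a C1.Icarr by blast
    then have d10: "d1 \<noteq> 0" using d1(1)[OF C1.Icarr[OF a(1)]] a(1) by auto
    have "\<psi> d1 \<in> C 1" using d1(1) psi_closed by (simp add: phi_psi)
    then have "d2 dvd d1" using sub d2(1) psi_closed by (metis phi_psi psubsetD)
    then obtain h where h: "d1 = d2 * h" ..
    have "\<not> d1 dvd d2"
    proof
      assume dvd: "d1 dvd d2"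
      have "C 2 \<subseteq> C 1"
      proof
        fix x assume x: "x \<in> C 2"
        then have "d1 dvd \<phi> x" using dvd_trans[OF dvd] d2(1)[OF C2.Icarr[OF x]] by simp
        then show "x \<in> C 1" using d1(1)[OF C2.Icarr[OF x]] by simp
      qed
      then show False using sub by blast
    qed
    then have "d1 dvd h" using d1(2)[of d2 h] h by simp
    then obtain e where "h = d1 * e" ..
    then have "d1 * 1 = d1 * (d2 * e)" using h by (simp add: ac_simps)
    then have "1 = d2 * e" using d10 by (metis mult_left_cancel)
    then show False using d2(2) by (metis dvd_triv_left)
  qed
  show ?thesis
    unfolding height_def
  proof (rule antisym)
    show "(SUP n \<in> {n. \<exists>C. C n = P \<and> (\<forall>i \<le> n. primeideal (C i) G) \<and>
       (\<forall>i < n. C i \<subset> C (i + 1))}. enat n) \<le> 1"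
      using bound by (intro SUP_least) (auto simp: one_enat_def)
    show "1 \<le> (SUP n \<in> {n. \<exists>C. C n = P \<and> (\<forall>i \<le> n. primeideal (C i) G) \<and>
       (\<forall>i < n. C i \<subset> C (i + 1))}. enat n)"
      using one by (intro SUP_upper2[of 1]) (auto simp: one_enat_def)
  qed
qed

section \<open>Depth of a maximal ideal\<close>

lemma power_congruent:
  fixes N :: nat
  assumes "a \<in> carrier G" "b \<in> carrier G"
  shows "\<exists>c \<in> carrier G. (a \<oplus> b) [^] N = a \<otimes> c \<oplus> b [^] N"
proof (induction N)
  case 0
  then show ?case using assms by (intro bexI[of _ \<zero>]) auto
next
  case (Suc N)
  then obtain c where c: "c \<in> carrier G" "(a \<oplus> b) [^] N = a \<otimes> c \<oplus> b [^] N" by blast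
  have "(a \<otimes> c \<oplus> b [^] N) \<otimes> (a \<oplus> b) = a \<otimes> (c \<otimes> (a \<oplus> b) \<oplus> b [^] N) \<oplus> b [^] N \<otimes> b"
    if "b [^] N \<in> carrier G"
    using assms c(1) that by algebra
  then show ?case using assms c by (intro bexI[of _ "c \<otimes> (a \<oplus> b) \<oplus> b [^] N"]) auto
qed

text \<open>Modulo a, powers of a + n agree with powers of n, which eventually vanish. This lets
  elements of G be traded for their polynomial parts at the cost of a power.\<close>

lemma nil_perturbation:
  assumes "a \<in> carrier G" "n \<in> carrier G" "\<phi> n = 0"
  obtains N :: nat and c where "c \<in> carrier G" "(a \<oplus> n) [^] N = a \<otimes> c"
proof -
  obtain N :: nat where "n [^] N = \<zero>" using nil assms by blast
  then show ?thesis using power_congruent[OF assms(1,2), of N] that assms(1) by auto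
qed

lemma depth_maximal:
  assumes "maximalideal P G"
  shows "depth G P = 1"
proof -
  interpret P: maximalideal P G by fact
  obtain \<pi> where \<pi>: "\<And>a. a \<in> carrier G \<Longrightarrow> a \<in> P \<longleftrightarrow> \<pi> dvd \<phi> a"
    "\<not> \<pi> dvd 1" "\<And>p q. \<pi> dvd p * q \<Longrightarrow> \<pi> dvd p \<or> \<pi> dvd q" "\<pi> \<noteq> 0"
    using maximal_generator[OF assms] by metis
  have \<pi>P: "\<psi> \<pi> \<in> P" using \<pi>(1) psi_closed by (simp add: phi_psi)
  have gen_P: "genideal G A \<subseteq> P" if "A \<subseteq> P" for A
    by (rule genideal_minimal[OF P.is_ideal that])
  have gen_empty: "genideal G {} = {\<zero>}"
    using genideal_minimal[OF zeroideal, of "{}"] genideal_ideal[of "{}"]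
    by (auto dest: ideal.axioms(1) additive_subgroup.zero_closed)
  have "regular_sequence G [\<psi> \<pi>]"
    unfolding regular_sequence_def
    using psi_closed gen_P[of "{\<psi> \<pi>}"] \<pi>P P.I_notcarr P.a_subset
    by (auto simp: gen_empty intro: psi_regular[OF \<pi>(4)])
  then have one: "[\<psi> \<pi>] \<in> {xs. regular_sequence G xs \<and> set xs \<subseteq> P}"
    using \<pi>P by simp
  \<comment> \<open>Write $\phi(f_1) = \pi^e u$ with $\pi \nmid u$. Some power of $f_2$ times a power of $u$ lies in
     $(f_1)$; if $f_2$ were regular modulo $f_1$, that power of $u$ would lie in $(f_1) \subseteq P$.\<close>
  have bound: "length xs \<le> 1" if xs: "regular_sequence G xs" "set xs \<subseteq> P" for xs
  proof (rule ccontr)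
    assume "\<not> length xs \<le> 1"
    then have len: "0 < length xs" "1 < length xs" by auto
    define f1 where "f1 = xs ! 0"
    define f2 where "f2 = xs ! 1"
    have f1P: "f1 \<in> P" and f2P: "f2 \<in> P"
      using xs(2) len nth_mem unfolding f1_def f2_def by blast+
    then have f1: "f1 \<in> carrier G" and f2: "f2 \<in> carrier G" using P.Icarr by blast+
    have take1: "set (take 1 xs) = {f1}" using len unfolding f1_def by (cases xs) auto
    have reg1: "a = \<zero>" if "a \<in> carrier G" "f1 \<otimes> a = \<zero>" for a
      using xs(1) len(1) that gen_empty unfolding regular_sequence_def f1_def by force
    have gen1: "genideal G {f1} = {x \<otimes> f1 | x. x \<in> carrier G}"
      using cgenideal_eq_genideal[OF f1] unfolding cgenideal_def by simp
    have reg2: "a \<in> genideal G {f1}" if "a \<in> carrier G" "f2 \<otimes> a \<in> genideal G {f1}" for a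
      using xs(1) len(2) that take1 unfolding regular_sequence_def f2_def by metis
    obtain n1 where n1: "n1 \<in> carrier G" "\<phi> n1 = 0" "f1 = \<psi> (\<phi> f1) \<oplus> n1"
      using decompose[OF f1] .
    obtain n2 where n2: "n2 \<in> carrier G" "\<phi> n2 = 0" "f2 = \<psi> (\<phi> f2) \<oplus> n2"
      using decompose[OF f2] .
    \<comment> \<open>Otherwise f1 is both nilpotent and regular, and cancelling it repeatedly gives
      \<open>\<one> = \<zero>\<close>.\<close>
    have phi_f1: "\<phi> f1 \<noteq> 0"
    proof
      assume "\<phi> f1 = 0"
      then obtain N :: nat where "f1 [^] N = \<zero>" using nil f1 by blast
      then have "\<one> = \<zero>"
      proof (induction N)
        case (Suc N)
        then show ?case using reg1[of "f1 [^] N"] f1 by (simp add: m_comm)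
      qed simp
      then show False using phi_one phi_zero by simp
    qed
    have mn: "\<phi> (\<ominus> n1) = 0"
      using phi_add[of n1 "\<ominus> n1"] n1 phi_zero by (simp add: r_neg)
    obtain N1 :: nat and c1 where c1: "c1 \<in> carrier G" "(f1 \<oplus> \<ominus> n1) [^] N1 = f1 \<otimes> c1"
      using nil_perturbation[OF f1 a_inv_closed[OF n1(1)] mn] .
    have "f1 \<oplus> \<ominus> n1 = \<psi> (\<phi> f1)"
      using n1 psi_closed by (metis add.inv_solve_right' f1 minus_eq)
    then have p1: "\<psi> (\<phi> f1 ^ N1) = f1 \<otimes> c1" using c1(2) by (simp add: psi_power)
    obtain N2 :: nat and c2 where c2: "c2 \<in> carrier G" "f2 [^] N2 = \<psi> (\<phi> f2) \<otimes> c2"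
      using nil_perturbation[OF psi_closed n2(1,2)] n2(3) by metis
    obtain e u where eu: "\<phi> f1 = \<pi> ^ e * u" "\<not> \<pi> dvd u"
      using poly_extract_power[OF \<pi>(2) phi_f1] .
    obtain w where w: "\<phi> f2 = \<pi> * w" using \<pi>(1)[OF f2] f2P by (auto elim: dvdE)
    \<comment> \<open>Chosen to match the powers of \<pi>: since
      \<open>\<phi> f2 = \<pi> * w\<close>, the power \<open>\<phi> f2 ^ ?M\<close> supplies the
      factor \<open>\<pi> ^ (e * N1)\<close> that \<open>u ^ N1\<close> lacks to become
      \<open>\<phi> f1 ^ N1\<close>.\<close>
    let ?M = "e * N1"
    have "f2 [^] (N2 * ?M) = (\<psi> (\<phi> f2) \<otimes> c2) [^] ?M"
      using c2 f2 by (simp add: nat_pow_pow[symmetric])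
    also have "\<dots> = \<psi> (\<phi> f2 ^ ?M) \<otimes> c2 [^] ?M"
      using c2 psi_closed by (simp add: nat_pow_distrib psi_power)
    finally have "f2 [^] (N2 * ?M) \<otimes> \<psi> (u ^ N1) = \<psi> (\<phi> f2 ^ ?M) \<otimes> c2 [^] ?M \<otimes> \<psi> (u ^ N1)"
      by simp
    also have "\<dots> = \<psi> (\<phi> f2 ^ ?M * u ^ N1) \<otimes> c2 [^] ?M"
      using c2(1) psi_closed by (simp add: psi_mult m_ac)
    also have "\<phi> f2 ^ ?M * u ^ N1 = w ^ ?M * \<phi> f1 ^ N1"
      by (simp add: w eu(1) power_mult_distrib ac_simps flip: power_mult)
    also have "\<psi> (w ^ ?M * \<phi> f1 ^ N1) \<otimes> c2 [^] ?M = \<psi> (w ^ ?M) \<otimes> c1 \<otimes> c2 [^] ?M \<otimes> f1"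
      using c1(1) c2(1) f1 psi_closed by (simp add: psi_mult p1 m_ac)
    finally have "f2 [^] (N2 * ?M) \<otimes> \<psi> (u ^ N1) \<in> genideal G {f1}"
      unfolding gen1 using c1(1) c2(1) psi_closed by blast
    \<comment> \<open>Regularity of f2 modulo f1 removes the factors f2 one at a time.\<close>
    moreover have "v \<in> genideal G {f1}"
      if "v \<in> carrier G" "f2 [^] K \<otimes> v \<in> genideal G {f1}" for K :: nat and v
      using that
    proof (induction K arbitrary: v)
      case (Suc K)
      have "f2 [^] K \<otimes> (f2 \<otimes> v) \<in> genideal G {f1}"
        using Suc.prems f2 by (simp add: m_assoc)
      then have "f2 \<otimes> v \<in> genideal G {f1}" using Suc f2 by simp
      then show ?case using reg2 Suc.prems(1) by blast
    qed simp
    ultimately have "\<psi> (u ^ N1) \<in> genideal G {f1}" using psi_closed by blast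
    then have "\<psi> (u ^ N1) \<in> P" using gen_P[of "{f1}"] f1P by blast
    then have "\<pi> dvd u ^ N1" using \<pi>(1) psi_closed by (simp add: phi_psi)
    then have "\<pi> dvd u"
      by (induction N1) (use \<pi>(2,3) in auto)
    then show False using eu(2) by simp
  qed
  show ?thesis
    unfolding depth_def
  proof (rule antisym)
    show "(SUP xs \<in> {xs. regular_sequence G xs \<and> set xs \<subseteq> P}. enat (length xs)) \<le> 1"
      using bound by (intro SUP_least) (auto simp: one_enat_def)
    show "1 \<le> (SUP xs \<in> {xs. regular_sequence G xs \<and> set xs \<subseteq> P}. enat (length xs))"
      using one by (intro SUP_upper2[OF one]) (auto simp: one_enat_def)
  qed
qed

theorem cohen_macaulay: "cohen_macaulay G"
  unfolding cohen_macaulay_def using height_maximal depth_maximal by simp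

end

section \<open>Orders in a semigroup with three generators\<close>

locale three_generators =
  fixes g1 g2 g3 :: nat
  assumes g1_pos: "0 < g1" and g1_less_g2: "g1 < g2" and g2_less_g3: "g2 < g3"
begin

definition rep :: "nat \<Rightarrow> nat \<Rightarrow> bool" where
  "rep s h \<longleftrightarrow> (\<exists>a b c. s = a * g1 + b * g2 + c * g3 \<and> h = a + b + c)"

definition S :: "nat set" where
  "S = {s. \<exists>h. rep s h}"

text \<open>Lengths of expressions of s are bounded by s, so the greatest one exists for s in S.
  Outside S there is no length, and the value carries no meaning.\<close>

definition ord :: "nat \<Rightarrow> nat" where
  "ord s = (GREATEST h. rep s h)"

lemma repI: "rep (a * g1 + b * g2 + c * g3) (a + b + c)"
  unfolding rep_def by blast

lemma rep_0: "rep 0 0" and rep_g1: "rep g1 1" and rep_g2: "rep g2 1" and rep_g3: "rep g3 1"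
  using repI[of 0 0 0] repI[of 1 0 0] repI[of 0 1 0] repI[of 0 0 1] by auto

lemma rep_add:
  assumes "rep s h" "rep t k" shows "rep (s + t) (h + k)"
proof -
  obtain a b c a' b' c' where "s = a * g1 + b * g2 + c * g3" "h = a + b + c"
    "t = a' * g1 + b' * g2 + c' * g3" "k = a' + b' + c'"
    using assms unfolding rep_def by blast
  then show ?thesis
    using repI[of "a + a'" "b + b'" "c + c'"] by (simp add: algebra_simps)
qed

lemma rep_mult_le: assumes "rep s h" shows "h * g1 \<le> s"
proof -
  obtain a b c where "s = a * g1 + b * g2 + c * g3" "h = a + b + c"
    using assms unfolding rep_def by blast
  moreover have "b * g1 \<le> b * g2" "c * g1 \<le> c * g3"
    using g1_less_g2 g2_less_g3 by simp_all
  moreover have "h * g1 = a * g1 + b * g1 + c * g1"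
    using calculation(2) by (simp add: algebra_simps)
  ultimately show ?thesis by linarith
qed

lemma rep_le: "rep s h \<Longrightarrow> h \<le> s"
  using rep_mult_le[of s h] g1_pos by (cases g1) auto

lemma rep_ord: "s \<in> S \<Longrightarrow> rep s (ord s)"
  unfolding ord_def S_def using GreatestI_ex_nat[of "rep s" s] rep_le by blast

lemma ord_ge: "rep s h \<Longrightarrow> h \<le> ord s"
  unfolding ord_def using Greatest_le_nat[of "rep s" h s] rep_le by blast

lemma S_rep: "rep s h \<Longrightarrow> s \<in> S"
  unfolding S_def by blast

lemma zero_in_S: "0 \<in> S" and g1_in_S: "g1 \<in> S" and g2_in_S: "g2 \<in> S" and g3_in_S: "g3 \<in> S"
  using rep_0 rep_g1 rep_g2 rep_g3 S_rep by blast+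

lemma S_add: "s \<in> S \<Longrightarrow> t \<in> S \<Longrightarrow> s + t \<in> S"
  by (meson S_rep rep_add rep_ord)

lemma ord_add: "s \<in> S \<Longrightarrow> t \<in> S \<Longrightarrow> ord s + ord t \<le> ord (s + t)"
  by (simp add: ord_ge rep_add rep_ord)

lemma ord_mult_le: "s \<in> S \<Longrightarrow> ord s * g1 \<le> s"
  by (simp add: rep_mult_le rep_ord)

lemma ord_mult_g1: "ord (n * g1) = n" and mult_g1_in_S: "n * g1 \<in> S"
proof -
  have r: "rep (n * g1) n" using repI[of n 0 0] by simp
  then show "n * g1 \<in> S" by (rule S_rep)
  then show "ord (n * g1) = n"
    using ord_ge[OF r] ord_mult_le[of "n * g1"] g1_pos by simp
qed

lemma ord_0: "ord 0 = 0" and ord_g1: "ord g1 = 1"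
  using ord_mult_g1[of 0] ord_mult_g1[of 1] by simp_all

lemma ord_pos: assumes "s \<in> S" "s \<noteq> 0" shows "0 < ord s"
proof -
  obtain a b c where "s = a * g1 + b * g2 + c * g3" "ord s = a + b + c"
    using rep_ord[OF assms(1)] unfolding rep_def by blast
  with assms(2) show ?thesis by (cases "a + b + c") auto
qed

text \<open>Superadditivity of \<open>ord\<close> leaves no slack: each part of a longest expression
  is itself a longest expression.\<close>

lemma rep_split_ord:
  assumes "rep u i" "rep v j" "ord (u + v) = i + j"
  shows "ord u = i" "ord v = j"
  using assms ord_ge[OF assms(1)] ord_ge[OF assms(2)]
    ord_add[OF S_rep[OF assms(1)] S_rep[OF assms(2)]] by linarith+

lemma rep_max_bound:
  assumes "ord (a * g1 + b * g2 + c * g3) = a + b + c"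
  shows "b < g1" "c < g1"
proof -
  show "b < g1"
  proof (rule ccontr)
    assume "\<not> b < g1"
    then obtain b' where b: "b = g1 + b'" by (metis le_Suc_ex not_less)
    show False
      using ord_ge[OF repI[of "a + g2" b' c]] assms g1_less_g2
      unfolding b by (simp add: algebra_simps)
  qed
  show "c < g1"
  proof (rule ccontr)
    assume "\<not> c < g1"
    then obtain c' where c: "c = g1 + c'" by (metis le_Suc_ex not_less)
    show False
      using ord_ge[OF repI[of "a + g3" b c']] assms g1_less_g2 g2_less_g3
      unfolding c by (simp add: algebra_simps)
  qed
qed

text \<open>Fewer than \<open>2 * g1\<close> summands are g2 or g3, so at least n summands are g1.
  This is the origin of \<open>2 * g1\<close> in the exponents below.\<close>

lemma split_mult_g1:
  assumes "v \<in> S" "n + 2 * g1 \<le> ord v"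
  obtains v' where "v' \<in> S" "v = n * g1 + v'" "ord v = n + ord v'"
proof -
  obtain a b c where r: "v = a * g1 + b * g2 + c * g3" "ord v = a + b + c"
    using rep_ord[OF assms(1)] unfolding rep_def by blast
  have "b < g1" "c < g1" using rep_max_bound r by metis+
  then have "n \<le> a" using assms r by linarith
  then obtain a' where a: "a = n + a'" using le_Suc_ex by blast
  let ?v' = "a' * g1 + b * g2 + c * g3"
  have v: "v = n * g1 + ?v'" using r a by (simp add: algebra_simps)
  have n: "rep (n * g1) n" using repI[of n 0 0] by simp
  have "ord ?v' = a' + b + c"
    using rep_split_ord(2)[OF n repI[of a' b c]] v r a by (simp add: algebra_simps)
  then show ?thesis using that[of ?v'] v r(2) a S_rep[OF repI] by simp
qed

text \<open>The defect is additive on nonzero products of classes, bounded, and 0 only on the powers of $x$: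
  this makes the kernel of the retraction nilpotent.\<close>

definition defect :: "nat \<Rightarrow> nat" where
  "defect s = s - ord s * g1"

text \<open>A summand g1 contributes 0 to the defect, and each of the fewer than
  \<open>2 * g1\<close> other summands contributes less than g3.\<close>

lemma defect_bound: assumes "s \<in> S" shows "defect s \<le> 2 * g1 * g3"
proof -
  obtain a b c where r: "s = a * g1 + b * g2 + c * g3" "ord s = a + b + c"
    using rep_ord[OF assms(1)] unfolding rep_def by blast
  have "b < g1" "c < g1" using rep_max_bound r by metis+
  then have "b * g2 \<le> g1 * g3" "c * g3 \<le> g1 * g3"
    using g2_less_g3 by (auto intro: mult_mono)
  moreover have "s - ord s * g1 \<le> b * g2 + c * g3" using r by (simp add: algebra_simps)
  ultimately show ?thesis unfolding defect_def by linarith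
qed

lemma defect_add:
  assumes "u \<in> S" "v \<in> S" "ord (u + v) = ord u + ord v"
  shows "defect (u + v) = defect u + defect v"
  using assms ord_mult_le[of u] ord_mult_le[of v] unfolding defect_def
  by (simp add: algebra_simps)

lemma defect_0_iff: assumes "s \<in> S" shows "defect s = 0 \<longleftrightarrow> s = ord s * g1"
  using ord_mult_le[OF assms] unfolding defect_def by auto

text \<open>\<open>torsion s\<close> says that the class of $t^s$ is killed by a power of the class of $t^{g_1}$.\<close>

definition torsion :: "nat \<Rightarrow> bool" where
  "torsion s \<longleftrightarrow> s \<in> S \<and> (\<exists>n. ord s + n < ord (s + n * g1))"

text \<open>\<open>soc\<close> is the Buchsbaum condition in terms of orders: a torsion class is
  killed by every class of positive degree.\<close>

theorem torsion_unique:
  assumes soc: "\<And>s u. torsion s \<Longrightarrow> u \<in> S \<Longrightarrow> u \<noteq> 0 \<Longrightarrow> ord (s + u) \<noteq> ord s + ord u"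
    and s: "torsion s"
  shows "s = (LEAST j. g2 dvd (j + 1) * g3 \<or> (j + 1) * g3 - g1 \<in> S) * g3"
proof -
  have sS: "s \<in> S" using s unfolding torsion_def by simp
  \<comment> \<open>Adding g1 raises the order by at least 1, and \<open>soc\<close> excludes
    exactly 1.\<close>
  have o1: "ord s + 2 \<le> ord (s + g1)"
    using soc[OF s g1_in_S] ord_add[OF sS g1_in_S] g1_pos ord_g1 by simp
  obtain a b c where r: "s = a * g1 + b * g2 + c * g3" "ord s = a + b + c"
    using rep_ord[OF sS] unfolding rep_def by blast
  obtain a' b' c' where r': "s + g1 = a' * g1 + b' * g2 + c' * g3" "ord (s + g1) = a' + b' + c'"
    using rep_ord[OF S_add[OF sS g1_in_S]] unfolding rep_def by blast
  \<comment> \<open>Removing a summand g1 would leave an expression of s with more than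
    \<open>ord s\<close> summands.\<close>
  have a'0: "a' = 0"
  proof (rule ccontr)
    assume "a' \<noteq> 0"
    then obtain a'' where "a' = Suc a''" by (cases a') auto
    then have "s = a'' * g1 + b' * g2 + c' * g3" "ord (s + g1) = Suc (a'' + b' + c')"
      using r' by simp_all
    then show False using ord_ge[OF repI[of a'' b' c']] o1 by simp
  qed
  have eq: "(a + 1) * g1 + b * g2 + c * g3 = b' * g2 + c' * g3"
    using r(1) r'(1) a'0 by (simp add: algebra_simps)
  have len: "a + b + c + 2 \<le> b' + c'" using o1 r r' a'0 by simp
  have mono: "i * g1 \<le> i * g2" "i * g2 \<le> i * g3" for i
    using g1_less_g2 g2_less_g3 by simp_all
  \<comment> \<open>Otherwise cancelling \<open>c * g3\<close> leaves at least
    \<open>a + b + 2\<close> summands on the right, none below g2. Their sum exceeds that of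
    \<open>a + 1\<close> copies of g1 and b copies of g2.\<close>
  have cc: "c' < c"
  proof (rule ccontr)
    assume "\<not> c' < c"
    then obtain y where y: "c' = c + y" by (metis le_Suc_ex not_less)
    have "(a + 1) * g1 + b * g2 = b' * g2 + y * g3" using eq y by (simp add: algebra_simps)
    moreover have "a + b + 2 \<le> b' + y" using len y by simp
    then have "(a + b + 2) * g2 \<le> (b' + y) * g2" by (rule mult_right_mono) simp
    moreover have "(a + b + 2) * g2 = (a + 1) * g2 + b * g2 + g2" by (simp add: algebra_simps)
    moreover have "(b' + y) * g2 = b' * g2 + y * g2" by (simp add: algebra_simps)
    ultimately show False using mono(1)[of "a + 1"] mono(2)[of y] g1_less_g2 by linarith
  qed
  have bb: "b < b'" using len cc by linarith
  obtain \<beta> where \<beta>: "b' = b + \<beta>" using bb le_Suc_ex less_imp_le by blast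
  have eq': "(a + 1) * g1 + c * g3 = \<beta> * g2 + c' * g3" using eq \<beta> by (simp add: algebra_simps)
  have len': "a + c + 2 \<le> \<beta> + c'" using len \<beta> by simp
  \<comment> \<open>The b copies of g2 have cancelled from \<open>eq'\<close>, which therefore shows
    that s1 is already torsion. The orders of s1 and \<open>b * g2\<close> add up, so
    \<open>soc\<close> leaves only b = 0.\<close>
  define s1 where "s1 = a * g1 + c * g3"
  have rs1: "rep s1 (a + c)" using repI[of a 0 c] unfolding s1_def by simp
  have rb: "rep (b * g2) b" using repI[of 0 b 0] by simp
  have s_split: "s = s1 + b * g2" using r(1) unfolding s1_def by simp
  have o_s1: "ord s1 = a + c" "ord (b * g2) = b"
    using rep_split_ord[OF rs1 rb] r(2) s_split by auto
  have "rep (s1 + 1 * g1) (\<beta> + c')"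
    using repI[of 0 \<beta> c'] eq' unfolding s1_def by (simp add: algebra_simps)
  from ord_ge[OF this] have "torsion s1"
    unfolding torsion_def using S_rep[OF rs1] o_s1 len' by (auto intro!: exI[of _ 1])
  then have b0: "b = 0"
    using soc[of s1 "b * g2"] S_rep[OF rb] o_s1 r(2) s_split g1_less_g2 by auto
  have rc: "rep (c * g3) c" using repI[of 0 0 c] by simp
  have ra: "rep (a * g1) a" using repI[of a 0 0] by simp
  have s_split': "s = c * g3 + a * g1" using r(1) b0 by simp
  have o_c: "ord (c * g3) = c"
    using rep_split_ord[OF rc ra] r(2) s_split' b0 by auto
  \<comment> \<open>Now all \<open>a + 1\<close> copies of g1 serve as the multiplier:
    \<open>c * g3\<close> itself is torsion, and \<open>soc\<close> against \<open>a * g1\<close>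
    gives a = 0.\<close>
  have "rep (c * g3 + (a + 1) * g1) (\<beta> + c')"
    using repI[of 0 \<beta> c'] eq' by (simp add: algebra_simps)
  from ord_ge[OF this] have tc: "torsion (c * g3)"
    unfolding torsion_def using S_rep[OF rc] o_c len' by (auto intro!: exI[of _ "a + 1"])
  then have "a = 0"
    using soc[of "c * g3" "a * g1"] S_rep[OF ra] o_c r(2) s_split' b0 g1_pos
    by (auto simp: ord_mult_g1)
  then have s_eq: "s = c * g3" using s_split' by simp
  have "ord g3 \<ge> 1" using ord_ge[OF rep_g3] .
  then have o_Suc: "c + 2 \<le> ord (c * g3 + g3)"
    using soc[OF tc g3_in_S] ord_add[OF S_rep[OF rc] g3_in_S] g2_less_g3 o_c by simp
  obtain p q u where z: "c * g3 + g3 = p * g1 + q * g2 + u * g3" "ord (c * g3 + g3) = p + q + u"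
    using rep_ord[OF S_add[OF S_rep[OF rc] g3_in_S]] unfolding rep_def by blast
  \<comment> \<open>Some expression of \<open>(c + 1) * g3\<close> has at least c + 2 summands. If
    g1 is absent from it, so is g3, since removing one g3 would leave more than c summands for
    \<open>c * g3\<close>; then all summands are g2.\<close>
  have P: "g2 dvd (c + 1) * g3 \<or> (c + 1) * g3 - g1 \<in> S"
  proof (cases p)
    case (Suc p')
    have "(c + 1) * g3 - g1 = p' * g1 + q * g2 + u * g3"
      using z(1) Suc by simp
    then show ?thesis using S_rep[OF repI] by metis
  next
    case 0
    show ?thesis
    proof (cases u)
      case 0
      then have "(c + 1) * g3 = q * g2" using z(1) \<open>p = 0\<close> by simp
      then show ?thesis by simp
    next
      case (Suc u')
      have "c * g3 = 0 * g1 + q * g2 + u' * g3" using z(1) Suc \<open>p = 0\<close> by simp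
      then have "q + u' \<le> c" using ord_ge[OF repI[of 0 q u']] o_c by simp
      then show ?thesis using z(2) Suc \<open>p = 0\<close> o_Suc by simp
    qed
  qed
  \<comment> \<open>For j < c, \<open>(j + 1) * g3\<close> is part of a longest expression and has
    order j + 1. Either alternative would rewrite it with more summands, because g1 and g2 are
    smaller than g3.\<close>
  have least: "c \<le> j" if j: "g2 dvd (j + 1) * g3 \<or> (j + 1) * g3 - g1 \<in> S" for j
  proof (rule ccontr)
    assume "\<not> c \<le> j"
    then obtain d where d: "c = (j + 1) + d" by (metis Suc_eq_plus1 Suc_leI le_Suc_ex not_less)
    have r1: "rep ((j + 1) * g3) (j + 1)" using repI[of 0 0 "j + 1"] by simp
    have r2: "rep (d * g3) d" using repI[of 0 0 d] by simp
    have oj: "ord ((j + 1) * g3) = j + 1"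
      using rep_split_ord[OF r1 r2] o_c d by (simp add: algebra_simps)
    from j show False
    proof
      assume "g2 dvd (j + 1) * g3"
      then obtain q where q: "(j + 1) * g3 = q * g2" by (metis dvdE mult.commute)
      have "(j + 1) * g2 < (j + 1) * g3" by (rule mult_strict_left_mono) (use g2_less_g3 in auto)
      then have "(j + 1) * g2 < q * g2" using q by simp
      then have "j + 1 < q" by (rule mult_right_less_imp_less) simp
      then show False using ord_ge[OF repI[of 0 q 0]] q oj by simp
    next
      assume "(j + 1) * g3 - g1 \<in> S"
      then obtain p q u where w: "(j + 1) * g3 - g1 = p * g1 + q * g2 + u * g3"
        unfolding S_def rep_def by blast
      \<comment> \<open>This rules out truncation in the subtraction of g1.\<close>
      have "g1 \<le> (j + 1) * g3" using g1_less_g2 g2_less_g3 by simp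
      then have w': "(j + 1) * g3 = (p + 1) * g1 + q * g2 + u * g3" using w by simp
      have "(p + 1) * g1 + q * g2 + u * g3 < (p + 1) * g3 + q * g3 + u * g3"
      proof -
        have "(p + 1) * g1 < (p + 1) * g3" by (rule mult_strict_left_mono) (use g1_less_g2 g2_less_g3 in auto)
        then show ?thesis using mono(2)[of q] by linarith
      qed
      then have "(j + 1) * g3 < (p + 1 + q + u) * g3" using w' by (simp add: algebra_simps)
      then have "j + 1 < p + 1 + q + u" by (rule mult_right_less_imp_less) simp
      then show False using ord_ge[OF repI[of "p + 1" q u]] w' oj by simp
    qed
  qed
  have "(LEAST j. g2 dvd (j + 1) * g3 \<or> (j + 1) * g3 - g1 \<in> S) = c"
    using P least by (intro Least_equality)
  then show ?thesis using s_eq by simp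
qed

section \<open>Agreement with the generated semigroup and its sets hM\<close>

lemma nsgen_eq_S: "nsgen {g1, g2, g3} = S"
proof
  show "nsgen {g1, g2, g3} \<subseteq> S"
  proof
    fix s assume "s \<in> nsgen {g1, g2, g3}"
    then show "s \<in> S"
    proof induction
      case (add s a)
      then have "a \<in> S" using g1_in_S g2_in_S g3_in_S by blast
      then show ?case using add S_add by simp
    qed (rule zero_in_S)
  qed
  have mult: "s + n * a \<in> nsgen A" if "s \<in> nsgen A" "a \<in> A" for s n a A
  proof (induction n)
    case (Suc n)
    then show ?case using nsgen.add[OF Suc \<open>a \<in> A\<close>] by (simp add: add_ac)
  qed (use that in simp)
  show "S \<subseteq> nsgen {g1, g2, g3}"
  proof
    fix s assume "s \<in> S"
    then obtain a b c where s: "s = 0 + a * g1 + b * g2 + c * g3"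
      unfolding S_def rep_def by auto
    have "0 + a * g1 + b * g2 + c * g3 \<in> nsgen {g1, g2, g3}"
      by (rule mult[OF mult[OF mult[OF nsgen.zero]]]) simp_all
    then show "s \<in> nsgen {g1, g2, g3}" unfolding s .
  qed
qed

text \<open>A nonzero summand raises the order by at least 1; conversely one generator can be taken
  off a longest expression.\<close>

lemma nfoldM_eq: "nfoldM S h = {s \<in> S. h \<le> ord s}"
proof (induction h)
  case (Suc h)
  show ?case
  proof (rule Set.set_eqI, rule iffI)
    fix s assume "s \<in> nfoldM S (Suc h)"
    then obtain a b where "s = a + b" "a \<in> S" "h \<le> ord a" "b \<in> S" "b \<noteq> 0"
      using Suc by auto
    then show "s \<in> {s \<in> S. Suc h \<le> ord s}"
      using ord_add[of a b] ord_pos[of b] S_add by simp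
  next
    fix s assume s: "s \<in> {s \<in> S. Suc h \<le> ord s}"
    then obtain a b c where r: "s = a * g1 + b * g2 + c * g3" "ord s = a + b + c"
      using rep_ord unfolding rep_def by blast
    have "\<exists>t g. s = t + g \<and> g \<in> {g1, g2, g3} \<and> rep t (ord s - 1)"
    proof -
      consider a' where "a = Suc a'" | b' where "b = Suc b'" | c' where "c = Suc c'"
        using s r(2) by (cases a; cases b; cases c) auto
      then show ?thesis
      proof cases
        case 1 then show ?thesis using repI[of a' b c] r
          by (intro exI[of _ "a' * g1 + b * g2 + c * g3"] exI[of _ g1]) simp
      next
        case 2 then show ?thesis using repI[of a b' c] r
          by (intro exI[of _ "a * g1 + b' * g2 + c * g3"] exI[of _ g2]) simp
      next
        case 3 then show ?thesis using repI[of a b c'] r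
          by (intro exI[of _ "a * g1 + b * g2 + c' * g3"] exI[of _ g3]) simp
      qed
    qed
    then obtain t g where t: "s = t + g" "g \<in> {g1, g2, g3}" "rep t (ord s - 1)" by blast
    from s have "Suc h \<le> ord s" by simp
    with ord_ge[OF t(3)] have "h \<le> ord t" by linarith
    then have "t \<in> nfoldM S h" unfolding Suc using S_rep[OF t(3)] by simp
    moreover have "g \<in> S - {0}"
      using t(2) g1_in_S g2_in_S g3_in_S g1_pos g1_less_g2 g2_less_g3 by auto
    ultimately show "s \<in> nfoldM S (Suc h)" using t(1) by auto
  qed
qed simp

lemma the_order: "s \<in> S \<Longrightarrow> (THE h. s \<in> nfoldM S h - nfoldM S (h + 1)) = ord s"
  unfolding nfoldM_eq by (rule the_equality) auto

lemma step_down: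
  assumes "s \<in> S" "h < ord s"
  obtains g where "g \<in> {g1, g2, g3}" "g \<le> s" "s - g \<in> S" "h \<le> ord (s - g)"
proof -
  obtain a b c where r: "s = a * g1 + b * g2 + c * g3" "ord s = a + b + c"
    using rep_ord[OF assms(1)] unfolding rep_def by blast
  consider a' where "a = Suc a'" | b' where "b = Suc b'" | c' where "c = Suc c'"
    using assms(2) r(2) by (cases a; cases b; cases c) auto
  then show ?thesis
  proof cases
    case 1
    then have "s = a' * g1 + b * g2 + c * g3 + g1" "ord s - 1 = a' + b + c"
      using r by (simp_all add: algebra_simps)
    then have "rep (s - g1) (ord s - 1)" "g1 \<le> s" using repI[of a' b c] by simp_all
    then show ?thesis using that[of g1] assms(2) S_rep[of "s - g1"] ord_ge[of "s - g1" "ord s - 1"]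
      by simp
  next
    case 2
    then have "s = a * g1 + b' * g2 + c * g3 + g2" "ord s - 1 = a + b' + c"
      using r by (simp_all add: algebra_simps)
    then have "rep (s - g2) (ord s - 1)" "g2 \<le> s" using repI[of a b' c] by simp_all
    then show ?thesis using that[of g2] assms(2) S_rep[of "s - g2"] ord_ge[of "s - g2" "ord s - 1"]
      by simp
  next
    case 3
    then have "s = a * g1 + b * g2 + c' * g3 + g3" "ord s - 1 = a + b + c'"
      using r by (simp_all add: algebra_simps)
    then have "rep (s - g3) (ord s - 1)" "g3 \<le> s" using repI[of a b c'] by simp_all
    then show ?thesis using that[of g3] assms(2) S_rep[of "s - g3"] ord_ge[of "s - g3" "ord s - 1"]
      by simp
  qed
qed

end

section \<open>The associated graded ring in coordinates\<close>

context three_generators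
begin

section \<open>Powers of the maximal ideal as an order filtration\<close>

abbreviation R :: "'k::field fps ring" where
  "R \<equiv> semigroup_ring S"

definition J :: "nat \<Rightarrow> 'k::field fps set" where
  "J h = {f. \<forall>n. fps_nth f n \<noteq> 0 \<longrightarrow> n \<in> S \<and> h \<le> ord n}"

lemma J_memD: "f \<in> J h \<Longrightarrow> fps_nth f n \<noteq> 0 \<Longrightarrow> n \<in> S \<and> h \<le> ord n"
  unfolding J_def by blast

lemma J_memI: "(\<And>n. fps_nth f n \<noteq> 0 \<Longrightarrow> n \<in> S \<and> h \<le> ord n) \<Longrightarrow> f \<in> J h"
  unfolding J_def by blast

lemma J_zero: "0 \<in> J h"
  by (rule J_memI) simp

lemma J_add: assumes "f \<in> J h" "g \<in> J h" shows "f + g \<in> J h"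
proof (rule J_memI)
  fix n assume "fps_nth (f + g) n \<noteq> 0"
  then have "fps_nth f n \<noteq> 0 \<or> fps_nth g n \<noteq> 0" by auto
  then show "n \<in> S \<and> h \<le> ord n" using assms J_memD by blast
qed

lemma J_uminus: "f \<in> J h \<Longrightarrow> - f \<in> J h"
  unfolding J_def by simp

lemma J_diff: "f \<in> J h \<Longrightarrow> g \<in> J h \<Longrightarrow> f - g \<in> J h"
  using J_add[OF _ J_uminus] by fastforce

lemma J_anti: "h \<le> k \<Longrightarrow> f \<in> J k \<Longrightarrow> f \<in> J h"
  unfolding J_def by (auto intro: order_trans)

lemma J_mult: assumes "f \<in> J h" "g \<in> J k" shows "f * g \<in> J (h + k)"
proof (rule J_memI)
  fix n assume "fps_nth (f * g) n \<noteq> 0"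
  then obtain i where i: "i \<le> n" "fps_nth f i \<noteq> 0" "fps_nth g (n - i) \<noteq> 0"
    unfolding fps_mult_nth by (metis (no_types, lifting) atLeastAtMost_iff mult_eq_0_iff sum.neutral)
  then show "n \<in> S \<and> h + k \<le> ord n"
    using J_memD[OF assms(1) i(2)] J_memD[OF assms(2) i(3)] S_add[of i "n - i"] ord_add[of i "n - i"]
    by simp
qed

lemma J_sum: "(\<And>i. i \<in> A \<Longrightarrow> f i \<in> J h) \<Longrightarrow> sum f A \<in> J h"
  by (induction A rule: infinite_finite_induct) (auto intro: J_zero J_add)

lemma X_power_J: "s \<in> S \<Longrightarrow> h \<le> ord s \<Longrightarrow> fps_X ^ s \<in> J h"
  by (rule J_memI) (auto simp: fps_X_power_nth split: if_splits)

lemma R_simps [simp]: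
  "carrier (R :: 'k::field fps ring) = J 0"
  "f \<otimes>\<^bsub>R\<^esub> g = f * (g :: 'k fps)" "f \<oplus>\<^bsub>R\<^esub> g = f + g"
  "\<one>\<^bsub>R\<^esub> = (1 :: 'k fps)" "\<zero>\<^bsub>R\<^esub> = (0 :: 'k fps)"
  unfolding semigroup_ring_def J_def by simp_all

lemma cring_R: "cring (R :: 'k::field fps ring)"
proof (rule cringI)
  show "abelian_group (R :: 'k fps ring)"
  proof (rule abelian_groupI)
    show "\<exists>y\<in>carrier R. y \<oplus>\<^bsub>R\<^esub> x = \<zero>\<^bsub>R\<^esub>" if "x \<in> carrier (R :: 'k fps ring)" for x
      using that J_uminus by (intro bexI[of _ "- x"]) auto
  qed (auto intro: J_add J_zero simp: add_ac)
  show "Group.comm_monoid (R :: 'k fps ring)"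
  proof (rule comm_monoidI)
    show "\<one>\<^bsub>R\<^esub> \<in> carrier (R :: 'k fps ring)"
      using X_power_J[OF zero_in_S, of 0, where 'a = 'k] by simp
  qed (use J_mult[of _ 0 _ 0] in \<open>auto simp: mult_ac\<close>)
qed (simp add: algebra_simps)

lemma ideal_J: "ideal (J h) (R :: 'k::field fps ring)"
proof (rule idealI)
  show "ring (R :: 'k fps ring)" using cring_R by (rule cring.axioms)
  then interpret ring "R :: 'k fps ring" .
  show "subgroup (J h) (add_monoid (R :: 'k fps ring))"
  proof (rule group.subgroupI)
    show "Group.group (add_monoid (R :: 'k fps ring))" by (rule add.is_group)
    show "J h \<subseteq> carrier (add_monoid (R :: 'k fps ring))" using J_anti[of 0 h] by auto
    show "J h \<noteq> {}" using J_zero by blast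
    show "inv\<^bsub>add_monoid R\<^esub> a \<in> J h" if "a \<in> J h" for a :: "'k fps"
    proof -
      have "a \<in> J 0" using that J_anti by blast
      then have "\<ominus>\<^bsub>R\<^esub> a = - a"
        using minus_equality[of "- a" a] J_uminus by auto
      then show ?thesis unfolding a_inv_def[symmetric] using J_uminus[OF that] by simp
    qed
  qed (auto intro: J_add)
qed (use J_mult[of _ h _ 0] J_mult[of _ 0 _ h] in auto)

text \<open>For each exponent in the support, choose a generator that can be taken off while keeping
  order at least h, and sort the terms of f by this choice. Infinitely many terms still make only
  three series.\<close>

lemma J_decompose:
  assumes f: "f \<in> J (Suc h)"
  obtains f1 f2 f3 where "f1 \<in> J h" "f2 \<in> J h" "f3 \<in> J h"
    "f = fps_X ^ g1 * f1 + fps_X ^ g2 * f2 + fps_X ^ g3 * f3"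
proof -
  have "\<exists>g. g \<in> {g1, g2, g3} \<and> g \<le> s \<and> s - g \<in> S \<and> h \<le> ord (s - g)" if "fps_nth f s \<noteq> 0" for s
    using J_memD[OF f that] step_down[of s h] by (metis Suc_le_lessD)
  then obtain \<gamma> where \<gamma>: "\<And>s. fps_nth f s \<noteq> 0 \<Longrightarrow>
      \<gamma> s \<in> {g1, g2, g3} \<and> \<gamma> s \<le> s \<and> s - \<gamma> s \<in> S \<and> h \<le> ord (s - \<gamma> s)"
    by metis
  define part where "part g = Abs_fps (\<lambda>n. if \<gamma> (n + g) = g then fps_nth f (n + g) else 0)" for g
  have part: "part g \<in> J h" for g
  proof (rule J_memI)
    fix n assume "fps_nth (part g) n \<noteq> 0"
    then have "\<gamma> (n + g) = g" "fps_nth f (n + g) \<noteq> 0"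
      unfolding part_def by (auto split: if_splits)
    then show "n \<in> S \<and> h \<le> ord n" using \<gamma>[of "n + g"] by simp
  qed
  have shift: "fps_nth (fps_X ^ g * part g) n = (if \<gamma> n = g \<and> g \<le> n then fps_nth f n else 0)" for g n
    unfolding part_def by (auto simp: fps_X_power_mult_nth)
  have "f = fps_X ^ g1 * part g1 + fps_X ^ g2 * part g2 + fps_X ^ g3 * part g3"
  proof (rule fps_ext)
    fix n
    show "fps_nth f n = fps_nth (fps_X ^ g1 * part g1 + fps_X ^ g2 * part g2 + fps_X ^ g3 * part g3) n"
      using \<gamma>[of n] g1_less_g2 g2_less_g3 by (cases "fps_nth f n = 0") (auto simp: shift)
  qed
  then show ?thesis using that part by blast
qed

lemma X_generators_J1: "fps_X ^ g1 \<in> J (Suc 0)" "fps_X ^ g2 \<in> J (Suc 0)" "fps_X ^ g3 \<in> J (Suc 0)"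
  using X_power_J[of g1 1] X_power_J[of g2 1] X_power_J[of g3 1] g1_in_S g2_in_S g3_in_S
    ord_ge[OF rep_g1] ord_ge[OF rep_g2] ord_ge[OF rep_g3] by auto

lemma maximal_ideal_eq:
  "genideal R {fps_X ^ g1, fps_X ^ g2, fps_X ^ g3} = (J (Suc 0) :: 'k::field fps set)"
proof
  interpret cring "R :: 'k fps ring" by (rule cring_R)
  show "genideal R {fps_X ^ g1, fps_X ^ g2, fps_X ^ g3} \<subseteq> (J (Suc 0) :: 'k fps set)"
    using X_generators_J1 by (intro genideal_minimal ideal_J) auto
  show "(J (Suc 0) :: 'k fps set) \<subseteq> genideal R {fps_X ^ g1, fps_X ^ g2, fps_X ^ g3}"
  proof
    fix f :: "'k fps" assume "f \<in> J (Suc 0)"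
    then obtain f1 f2 f3 where f: "f1 \<in> J 0" "f2 \<in> J 0" "f3 \<in> J 0"
      "f = fps_X ^ g1 * f1 + fps_X ^ g2 * f2 + fps_X ^ g3 * f3"
      using J_decompose[of f 0] by auto
    have sub: "{fps_X ^ g1, fps_X ^ g2, fps_X ^ g3} \<subseteq> carrier (R :: 'k fps ring)"
      using X_generators_J1 J_anti[of 0 1] by auto
    interpret I: ideal "genideal R {fps_X ^ g1, fps_X ^ g2, fps_X ^ g3 :: 'k fps}" R
      by (rule genideal_ideal[OF sub])
    have gen: "fps_X ^ g * f' \<in> genideal R {fps_X ^ g1, fps_X ^ g2, fps_X ^ g3}"
      if "g \<in> {g1, g2, g3}" "f' \<in> J 0" for g and f' :: "'k fps"
    proof -
      have "fps_X ^ g \<in> genideal R {fps_X ^ g1, fps_X ^ g2, fps_X ^ g3 :: 'k fps}"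
        using genideal_self[OF sub] that(1) by blast
      from I.I_r_closed[OF this, of f'] that(2) show ?thesis by simp
    qed
    show "f \<in> genideal R {fps_X ^ g1, fps_X ^ g2, fps_X ^ g3}"
      using I.a_closed[OF I.a_closed[OF gen gen] gen, of g1 f1 g2 f2 g3 f3] f by simp
  qed
qed

lemma ideal_pow_eq: "ideal_pow R (J (Suc 0)) h = (J h :: 'k::field fps set)"
proof -
  interpret cring "R :: 'k fps ring" by (rule cring_R)
  interpret I: Group.comm_monoid "ideals_set (R :: 'k fps ring)" by (rule ideals_set_is_comm_monoid)
  show ?thesis
  proof (induction h)
    case 0
    show ?case by (simp add: ideals_set_def)
  next
    case (Suc h)
    have prod: "ideal_prod R (J h) (J (Suc 0)) = (J (Suc h) :: 'k fps set)"
    proof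
      show "ideal_prod R (J h) (J (Suc 0)) \<subseteq> (J (Suc h) :: 'k fps set)"
      proof
        fix x :: "'k fps" assume "x \<in> ideal_prod R (J h) (J (Suc 0))"
        then show "x \<in> J (Suc h)"
          by induction (use J_mult[of _ h _ 1] J_add in auto)
      qed
      show "(J (Suc h) :: 'k fps set) \<subseteq> ideal_prod R (J h) (J (Suc 0))"
      proof
        fix f :: "'k fps" assume "f \<in> J (Suc h)"
        then obtain f1 f2 f3 where f: "f1 \<in> J h" "f2 \<in> J h" "f3 \<in> J h"
          "f = fps_X ^ g1 * f1 + fps_X ^ g2 * f2 + fps_X ^ g3 * f3"
          by (rule J_decompose)
        have prod: "fps_X ^ g * f' \<in> ideal_prod R (J h) (J (Suc 0))"
          if "f' \<in> J h" "(fps_X ^ g :: 'k fps) \<in> J (Suc 0)" for g and f' :: "'k fps"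
          using ideal_prod.prod[OF that, of R] by (simp add: mult.commute)
        show "f \<in> ideal_prod R (J h) (J (Suc 0))"
          using ideal_prod.sum[OF ideal_prod.sum[OF prod[OF f(1) X_generators_J1(1)]
                prod[OF f(2) X_generators_J1(2)]] prod[OF f(3) X_generators_J1(3)]] f(4)
          by simp
      qed
    qed
    have "ideal_pow R (J (Suc 0)) (Suc h) = ideal_prod R (ideal_pow R (J (Suc 0)) h) (J (Suc 0) :: 'k fps set)"
      by (simp add: ideals_set_def)
    then show ?case using Suc prod by simp
  qed
qed

lemma coset_eq: "J k +>\<^bsub>R\<^esub> a = {f. f - a \<in> J k}" for a :: "'k::field fps"
proof (rule Set.set_eqI)
  fix f :: "'k fps"
  have "f \<in> J k +>\<^bsub>R\<^esub> a \<longleftrightarrow> (\<exists>h\<in>J k. f = h + a)" by (auto simp: a_r_coset_def')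
  also have "\<dots> \<longleftrightarrow> f - a \<in> J k" by (metis diff_add_cancel add_diff_cancel)
  finally show "f \<in> J k +>\<^bsub>R\<^esub> a \<longleftrightarrow> f \<in> {f. f - a \<in> J k}" by simp
qed

lemma coset_eq_iff: "J k +>\<^bsub>R\<^esub> a = J k +>\<^bsub>R\<^esub> b \<longleftrightarrow> a - b \<in> J k" for a b :: "'k::field fps"
proof
  assume "J k +>\<^bsub>R\<^esub> a = J k +>\<^bsub>R\<^esub> b"
  moreover have "a \<in> J k +>\<^bsub>R\<^esub> a" by (simp add: coset_eq J_zero)
  ultimately show "a - b \<in> J k" by (simp add: coset_eq)
next
  assume ab: "a - b \<in> J k"
  have "f - a \<in> J k \<longleftrightarrow> f - b \<in> J k" for f
    using J_add[OF _ ab, of "f - a"] J_diff[OF _ ab, of "f - b"] by auto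
  then show "J k +>\<^bsub>R\<^esub> a = J k +>\<^bsub>R\<^esub> b" by (simp add: coset_eq)
qed

lemma coset_zero: "J k +>\<^bsub>R\<^esub> 0 = (J k :: 'k::field fps set)"
  by (simp add: coset_eq)

section \<open>Coordinates on the associated graded ring\<close>

abbreviation G :: "(nat \<Rightarrow> 'k::field fps set) ring" where
  "G \<equiv> assoc_graded R (J (Suc 0))"

abbreviation MM :: "(nat \<Rightarrow> 'k::field fps set) set" where
  "MM \<equiv> graded_max_ideal R (J (Suc 0))"

text \<open>The classes of the $t^s$ with $s \<in> S$ form a \<open>K\<close>-basis of the associated graded ring:
  \<open>mk c\<close> is the element with coordinates \<open>c\<close>, for \<open>c\<close> in \<open>coords\<close>.\<close>

definition coords :: "(nat \<Rightarrow> 'k::field) set" where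
  "coords = {c. finite {s. c s \<noteq> 0} \<and> (\<forall>s. c s \<noteq> 0 \<longrightarrow> s \<in> S)}"

definition part :: "(nat \<Rightarrow> 'k::field) \<Rightarrow> nat \<Rightarrow> 'k fps" where
  "part c i = Abs_fps (\<lambda>s. if s \<in> S \<and> ord s = i then c s else 0)"

definition mk :: "(nat \<Rightarrow> 'k::field) \<Rightarrow> nat \<Rightarrow> 'k fps set" where
  "mk c = (\<lambda>i. J (i + 1) +>\<^bsub>R\<^esub> part c i)"

text \<open>A convolution truncated to the pairs whose orders add; the remaining products lie in a
  higher power of the ideal.\<close>

definition conv :: "(nat \<Rightarrow> 'k::field) \<Rightarrow> (nat \<Rightarrow> 'k) \<Rightarrow> nat \<Rightarrow> 'k" where
  "conv c d s = (\<Sum>u\<le>s. if ord u + ord (s - u) = ord s then c u * d (s - u) else 0)"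

definition delta :: "nat \<Rightarrow> nat \<Rightarrow> 'k::field" where
  "delta s = (\<lambda>u. if u = s then 1 else 0)"

lemma coordsD: "c \<in> coords \<Longrightarrow> c s \<noteq> 0 \<Longrightarrow> s \<in> S"
  unfolding coords_def by blast

lemma part_nth: "fps_nth (part c i) s = (if s \<in> S \<and> ord s = i then c s else 0)"
  unfolding part_def by simp

lemma part_J: "part c i \<in> J i"
  by (rule J_memI) (auto simp: part_nth split: if_splits)

text \<open>An element of order i is at most \<open>i * g3\<close>. Hence finitely many nonzero
  components amount to finitely many nonzero coordinates.\<close>

lemma finite_degree: "finite {s \<in> S. ord s = i}"
proof (rule finite_subset)
  show "{s \<in> S. ord s = i} \<subseteq> {..i * g3}"
  proof
    fix s assume "s \<in> {s \<in> S. ord s = i}"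
    then obtain a b c where r: "s = a * g1 + b * g2 + c * g3" "i = a + b + c"
      using rep_ord[of s] unfolding rep_def by blast
    have "a * g1 \<le> a * g3" "b * g2 \<le> b * g3" using g1_less_g2 g2_less_g3 by simp_all
    moreover have "i * g3 = a * g3 + b * g3 + c * g3" using r(2) by (simp add: algebra_simps)
    ultimately have "s \<le> i * g3" using r(1) by linarith
    then show "s \<in> {..i * g3}" by simp
  qed
qed simp

lemma carrier_G: "carrier G = mk ` (coords :: (nat \<Rightarrow> 'k::field) set)"
proof (intro Set.set_eqI iffI)
  fix F :: "nat \<Rightarrow> 'k fps set"
  assume "F \<in> carrier G"
  then have F: "\<forall>i. \<exists>a \<in> J i. F i = J (i + 1) +>\<^bsub>R\<^esub> a" "finite {i. F i \<noteq> J (i + 1)}"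
    unfolding assoc_graded_def ideal_pow_eq by auto
  from F(1) obtain a where a: "\<And>i. a i \<in> J i" "\<And>i. F i = J (i + 1) +>\<^bsub>R\<^esub> a i" by metis
  \<comment> \<open>The coordinate at s is read off in degree \<open>ord s\<close>; terms of
    \<open>a i\<close> of order above i vanish in the quotient.\<close>
  define c where "c s = (if s \<in> S then fps_nth (a (ord s)) s else 0)" for s
  have "F i = mk c i" for i
  proof -
    have "a i - part c i \<in> J (i + 1)"
    proof (rule J_memI)
      fix n assume n: "fps_nth (a i - part c i) n \<noteq> 0"
      then have "fps_nth (a i) n \<noteq> 0" by (auto simp: part_nth c_def split: if_splits)
      then have "n \<in> S" "i \<le> ord n" using J_memD[OF a(1)] by blast+
      moreover have "ord n \<noteq> i" using n \<open>n \<in> S\<close> by (auto simp: part_nth c_def)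
      ultimately show "n \<in> S \<and> i + 1 \<le> ord n" by simp
    qed
    then show ?thesis unfolding mk_def a(2) coset_eq_iff .
  qed
  moreover have "c \<in> coords"
  proof -
    have "{s. c s \<noteq> 0} \<subseteq> (\<Union>i\<in>{i. F i \<noteq> J (i + 1)}. {s \<in> S. ord s = i})"
    proof
      fix s assume "s \<in> {s. c s \<noteq> 0}"
      then have s: "s \<in> S" "fps_nth (a (ord s)) s \<noteq> 0" by (auto simp: c_def split: if_splits)
      have "a (ord s) \<notin> J (ord s + 1)" using J_memD[OF _ s(2)] by force
      then have "F (ord s) \<noteq> J (ord s + 1)"
        unfolding a(2) using coset_eq_iff[of "ord s + 1" "a (ord s)" 0] coset_zero[of "ord s + 1", where 'k='k]
        by simp
      then show "s \<in> (\<Union>i\<in>{i. F i \<noteq> J (i + 1)}. {s \<in> S. ord s = i})" using s by simp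
    qed
    then have "finite {s. c s \<noteq> 0}"
      by (rule finite_subset) (intro finite_UN_I F(2) finite_degree)
    then show ?thesis unfolding coords_def by (auto simp: c_def)
  qed
  ultimately show "F \<in> mk ` coords" by blast
next
  fix F :: "nat \<Rightarrow> 'k fps set"
  assume "F \<in> mk ` coords"
  then obtain c where c: "c \<in> coords" "F = mk c" by blast
  have "{i. mk c i \<noteq> J (i + 1)} \<subseteq> ord ` {s. c s \<noteq> 0}"
  proof
    fix i assume "i \<in> {i. mk c i \<noteq> J (i + 1)}"
    moreover have "mk c i = J (i + 1)" if "part c i = 0" unfolding mk_def that coset_zero ..
    ultimately have "part c i \<noteq> 0" by blast
    then obtain s where "fps_nth (part c i) s \<noteq> 0" by (auto simp: fps_eq_iff)
    then show "i \<in> ord ` {s. c s \<noteq> 0}" by (auto simp: part_nth split: if_splits)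
  qed
  moreover have "finite (ord ` {s. c s \<noteq> 0})" using c(1) unfolding coords_def by blast
  ultimately have "finite {i. mk c i \<noteq> J (i + 1)}" by (rule finite_subset)
  moreover have "\<exists>a \<in> J i. mk c i = J (i + 1) +>\<^bsub>R\<^esub> a" for i
    unfolding mk_def using part_J by blast
  ultimately show "F \<in> carrier G"
    unfolding assoc_graded_def ideal_pow_eq c(2) by simp
qed

lemma mk_closed: "c \<in> coords \<Longrightarrow> mk c \<in> carrier G"
  using carrier_G by blast

lemma mk_nth_eq_iff: "mk c i = mk d i \<longleftrightarrow> (\<forall>s\<in>S. ord s = i \<longrightarrow> c s = d s)"
proof
  assume "mk c i = mk d i"
  then have *: "part c i - part d i \<in> J (i + 1)" unfolding mk_def coset_eq_iff .
  show "\<forall>s\<in>S. ord s = i \<longrightarrow> c s = d s"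
  proof (intro ballI impI, rule ccontr)
    fix s assume "s \<in> S" "ord s = i" "c s \<noteq> d s"
    then have "fps_nth (part c i - part d i) s \<noteq> 0" by (simp add: part_nth)
    then show False using J_memD[OF *] \<open>ord s = i\<close> by fastforce
  qed
next
  assume "\<forall>s\<in>S. ord s = i \<longrightarrow> c s = d s"
  then have "part c i = part d i" by (auto simp: fps_eq_iff part_nth)
  then show "mk c i = mk d i" unfolding mk_def by simp
qed

lemma mk_inject:
  assumes "c \<in> coords" "d \<in> coords" "mk c = mk d" shows "c = d"
proof
  fix s
  show "c s = d s"
  proof (cases "s \<in> S")
    case True
    then show ?thesis using mk_nth_eq_iff[of c "ord s" d] assms(3) by auto
  next
    case False
    then show ?thesis using coordsD assms(1,2) by metis
  qed
qed

lemma coords_zero: "(\<lambda>_. 0) \<in> coords"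
  unfolding coords_def by simp

lemma coords_delta: "s \<in> S \<Longrightarrow> delta s \<in> coords"
  unfolding coords_def delta_def by simp

lemma coords_add: assumes "c \<in> coords" "d \<in> coords" shows "(\<lambda>s. c s + d s) \<in> coords"
proof -
  have "{s. c s + d s \<noteq> 0} \<subseteq> {s. c s \<noteq> 0} \<union> {s. d s \<noteq> 0}" by auto
  moreover have "finite ({s. c s \<noteq> 0} \<union> {s. d s \<noteq> 0})" using assms unfolding coords_def by simp
  ultimately have "finite {s. c s + d s \<noteq> 0}" by (rule finite_subset)
  moreover have "s \<in> S" if "c s + d s \<noteq> 0" for s
    using that coordsD[OF assms(1), of s] coordsD[OF assms(2), of s] by fastforce
  ultimately show ?thesis unfolding coords_def by blast
qed

lemma conv_nonzero:
  assumes "conv c d s \<noteq> 0"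
  obtains u v where "s = u + v" "ord u + ord v = ord s" "c u \<noteq> 0" "d v \<noteq> 0"
proof -
  obtain u where "u \<in> {..s}" "(if ord u + ord (s - u) = ord s then c u * d (s - u) else 0) \<noteq> 0"
    using sum.not_neutral_contains_not_neutral[OF assms[unfolded conv_def]] by blast
  then show ?thesis using that[of u "s - u"] by (auto split: if_splits)
qed

lemma coords_conv: assumes "c \<in> coords" "d \<in> coords" shows "conv c d \<in> coords"
proof -
  have "{s. conv c d s \<noteq> 0} \<subseteq> (\<lambda>(u, v). u + v) ` ({u. c u \<noteq> 0} \<times> {v. d v \<noteq> 0})"
    by (auto elim!: conv_nonzero)
  moreover have "finite ({u. c u \<noteq> 0} \<times> {v. d v \<noteq> 0})" using assms unfolding coords_def by blast
  ultimately have "finite {s. conv c d s \<noteq> 0}" by (meson finite_imageI finite_subset)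
  then show ?thesis using assms S_add unfolding coords_def by (auto elim!: conv_nonzero)
qed

lemma conv_delta:
  assumes "t \<le> s"
  shows "conv c (delta t) s = (if ord (s - t) + ord t = ord s then c (s - t) else 0)"
proof -
  have "conv c (delta t) s =
      (\<Sum>u\<le>s. if u = s - t then (if ord (s - t) + ord t = ord s then c (s - t) else 0) else 0)"
    unfolding conv_def delta_def using assms by (intro sum.cong) auto
  then show ?thesis by simp
qed

lemma conv_commute: "conv c d = conv d c"
proof
  fix s
  show "conv c d s = conv d c s"
    unfolding conv_def
    by (rule sum.reindex_bij_witness[of _ "\<lambda>u. s - u" "\<lambda>u. s - u"]) (auto simp: add.commute)
qed

lemma add_mk:
  fixes c d :: "nat \<Rightarrow> 'k::field"
  shows "mk c \<oplus>\<^bsub>G\<^esub> mk d = mk (\<lambda>s. c s + d s)"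
proof
  fix i
  interpret I: ideal "J (i + 1)" "R :: 'k fps ring" by (rule ideal_J)
  have "part c i + part d i = part (\<lambda>s. c s + d s) i" by (auto simp: fps_eq_iff part_nth)
  moreover have "part c i \<in> J 0" "part d i \<in> J 0" using J_anti part_J by blast+
  ultimately show "(mk c \<oplus>\<^bsub>G\<^esub> mk d) i = mk (\<lambda>s. c s + d s) i"
    using I.a_rcos_sum[of "part c i" "part d i"]
    unfolding assoc_graded_def mk_def by simp
qed

lemma zero_mk: "\<zero>\<^bsub>G\<^esub> = mk (\<lambda>_. 0)"
proof
  fix i
  have p: "part (\<lambda>_. 0) i = 0" by (auto simp: fps_eq_iff part_nth)
  show "\<zero>\<^bsub>G\<^esub> i = mk (\<lambda>_. 0) i"
    unfolding mk_def p coset_zero assoc_graded_def ideal_pow_eq by simp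
qed

lemma part_delta: "s \<in> S \<Longrightarrow> part (delta s) i = (if i = ord s then fps_X ^ s else 0)"
  by (auto simp: fps_eq_iff part_nth delta_def fps_X_power_nth)

lemma one_mk: "\<one>\<^bsub>G\<^esub> = mk (delta 0)"
proof
  fix i
  show "\<one>\<^bsub>G\<^esub> i = mk (delta 0) i"
    unfolding mk_def part_delta[OF zero_in_S] ord_0 assoc_graded_def ideal_pow_eq
    by (simp add: coset_zero)
qed

lemma monomial_class_mk:
  assumes "s \<in> S" shows "monomial_class R (J (Suc 0)) S s = mk (delta s)"
  unfolding monomial_class_def Let_def ideal_pow_eq mk_def the_order[OF assms] part_delta[OF assms]
  by (rule ext) (simp add: coset_zero)

text \<open>The factors are cosets of different ideals. Independence of representatives holds since
  \<open>a' * b' - a * b = (a' - a) * b' + a * (b' - b)\<close>, and both terms lie in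
  \<open>J (i + j + 1)\<close>.\<close>

lemma rcoset_mult_J:
  fixes a b :: "'k::field fps"
  assumes a: "a \<in> J i" and b: "b \<in> J j"
  shows "rcoset_mult R (J (i + j + 1)) (J (i + 1) +>\<^bsub>R\<^esub> a) (J (j + 1) +>\<^bsub>R\<^esub> b)
    = J (i + j + 1) +>\<^bsub>R\<^esub> (a * b)"
proof -
  have "J (i + j + 1) +>\<^bsub>R\<^esub> (a' * b') = J (i + j + 1) +>\<^bsub>R\<^esub> (a * b)"
    if "a' - a \<in> J (i + 1)" "b' - b \<in> J (j + 1)" for a' b' :: "'k fps"
  proof -
    have "b' = b + (b' - b)" by simp
    then have "b' \<in> J j" using J_add[OF b J_anti[OF _ that(2)]] by auto
    then have "(a' - a) * b' \<in> J (i + 1 + j)" "a * (b' - b) \<in> J (i + (j + 1))"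
      using J_mult that a by blast+
    then have "(a' - a) * b' + a * (b' - b) \<in> J (i + j + 1)"
      using J_add by (simp add: ac_simps)
    then show ?thesis unfolding coset_eq_iff by (simp add: algebra_simps)
  qed
  moreover have "a - a \<in> J (i + 1)" "b - b \<in> J (j + 1)" by (simp_all add: J_zero)
  ultimately show ?thesis unfolding rcoset_mult_def coset_eq[of "i + 1"] coset_eq[of "j + 1"] R_simps
    by blast
qed

lemma finsum_cosets:
  fixes f :: "'i \<Rightarrow> 'k::field fps"
  assumes "finite A" "\<And>i. i \<in> A \<Longrightarrow> f i \<in> J 0" "\<And>i. i \<in> A \<Longrightarrow> g i = J k +>\<^bsub>R\<^esub> f i"
  shows "(\<Oplus>\<^bsub>R Quot J k\<^esub> i \<in> A. g i) = J k +>\<^bsub>R\<^esub> sum f A"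
proof -
  interpret I: ideal "J k" "R :: 'k fps ring" by (rule ideal_J)
  interpret Q: ring "R Quot (J k :: 'k fps set)" by (rule I.quotient_is_ring)
  have carr: "J k +>\<^bsub>R\<^esub> a \<in> carrier (R Quot J k)" if "a \<in> J 0" for a :: "'k fps"
    using I.a_rcosetsI[OF I.a_subset, of a] that by (simp add: FactRing_def)
  show ?thesis
    using assms
  proof (induction A rule: finite_induct)
    case empty
    then show ?case by (simp add: coset_zero) (simp add: FactRing_def)
  next
    case (insert x A)
    have "(\<Oplus>\<^bsub>R Quot J k\<^esub> i \<in> insert x A. g i) =
        g x \<oplus>\<^bsub>R Quot J k\<^esub> (\<Oplus>\<^bsub>R Quot J k\<^esub> i \<in> A. g i)"
      using insert carr by (intro Q.finsum_insert) auto
    also have "\<dots> = (J k +>\<^bsub>R\<^esub> f x) <+>\<^bsub>R\<^esub> (J k +>\<^bsub>R\<^esub> sum f A)"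
      using insert by (simp add: FactRing_def)
    also have "\<dots> = J k +>\<^bsub>R\<^esub> sum f (insert x A)"
      using I.a_rcos_sum[of "f x" "sum f A"] insert J_sum[of A f 0] by simp
    finally show ?case .
  qed
qed

text \<open>In degree n both representatives lie in \<open>J n\<close>, so only their coefficients
  at exponents of order exactly n have to be compared.\<close>

lemma mult_mk:
  fixes c d :: "nat \<Rightarrow> 'k::field"
  assumes c: "c \<in> coords" and d: "d \<in> coords"
  shows "mk c \<otimes>\<^bsub>G\<^esub> mk d = mk (conv c d)"
proof
  fix n
  let ?f = "\<lambda>i. part c i * part d (n - i)"
  have fJ: "?f i \<in> J n" if "i \<le> n" for i
    using J_mult[OF part_J[of c i] part_J[of d "n - i"]] that by simp
  have "(mk c \<otimes>\<^bsub>G\<^esub> mk d) n = (\<Oplus>\<^bsub>R Quot J (n + 1)\<^esub> i \<in> {..n}.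
      rcoset_mult R (J (n + 1)) (mk c i) (mk d (n - i)))"
    unfolding assoc_graded_def ideal_pow_eq by simp
  also have "\<dots> = J (n + 1) +>\<^bsub>R\<^esub> (\<Sum>i\<le>n. ?f i)"
  proof (rule finsum_cosets)
    fix i assume "i \<in> {..n}"
    then have i: "i \<le> n" by simp
    then show "?f i \<in> J 0" using fJ J_anti by blast
    show "rcoset_mult R (J (n + 1)) (mk c i) (mk d (n - i)) = J (n + 1) +>\<^bsub>R\<^esub> ?f i"
      using rcoset_mult_J[OF part_J[of c i] part_J[of d "n - i"]] i unfolding mk_def by simp
  qed simp
  also have "\<dots> = mk (conv c d) n"
    unfolding mk_def coset_eq_iff
  proof (rule J_memI)
    fix s assume s: "fps_nth ((\<Sum>i\<le>n. ?f i) - part (conv c d) n) s \<noteq> 0"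
    have "(\<Sum>i\<le>n. ?f i) - part (conv c d) n \<in> J n"
      using fJ by (intro J_diff J_sum part_J) auto
    then have sS: "s \<in> S" "n \<le> ord s" using J_memD s by blast+
    have "ord s \<noteq> n"
    proof
      assume os: "ord s = n"
      \<comment> \<open>For fixed u only the index \<open>i = ord u\<close> contributes, and only if
        the orders of u and s - u add up to n.\<close>
      have inner: "(\<Sum>i\<le>n. fps_nth (part c i) u * fps_nth (part d (n - i)) (s - u)) =
          (if ord u + ord (s - u) = ord s then c u * d (s - u) else 0)" if u: "u \<le> s" for u
      proof (cases "c u \<noteq> 0 \<and> d (s - u) \<noteq> 0")
        case False
        then show ?thesis by (auto simp: part_nth intro!: sum.neutral)
      next
        case True
        then have S: "u \<in> S" "s - u \<in> S" using coordsD c d by blast+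
        have le: "ord u \<le> n" using ord_add[OF S] u os by simp
        have "(\<Sum>i\<le>n. fps_nth (part c i) u * fps_nth (part d (n - i)) (s - u)) =
            (\<Sum>i\<le>n. if i = ord u then (if ord (s - u) = n - ord u then c u * d (s - u) else 0) else 0)"
          by (rule sum.cong) (auto simp: part_nth S)
        also have "\<dots> = (if ord (s - u) = n - ord u then c u * d (s - u) else 0)" using le by simp
        also have "\<dots> = (if ord u + ord (s - u) = ord s then c u * d (s - u) else 0)"
          using le os by auto
        finally show ?thesis .
      qed
      have "fps_nth (\<Sum>i\<le>n. ?f i) s =
          (\<Sum>i\<le>n. \<Sum>u\<in>{..s}. fps_nth (part c i) u * fps_nth (part d (n - i)) (s - u))"
        by (simp add: fps_sum_nth fps_mult_nth atMost_atLeast0)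
      also have "\<dots> = (\<Sum>u\<le>s. \<Sum>i\<le>n. fps_nth (part c i) u * fps_nth (part d (n - i)) (s - u))"
        by (rule sum.swap)
      also have "\<dots> = conv c d s" unfolding conv_def by (rule sum.cong) (auto simp: inner)
      finally show False using s os sS by (simp add: part_nth)
    qed
    then show "s \<in> S \<and> n + 1 \<le> ord s" using sS by simp
  qed
  finally show "(mk c \<otimes>\<^bsub>G\<^esub> mk d) n = mk (conv c d) n" .
qed

end

section \<open>Torsion, the Buchsbaum property and the annihilator\<close>

lemma ideal_pow_0: "ideal_pow R I 0 = carrier R"
  by (simp add: nat_pow_def ideals_set_def)

lemma ideal_pow_Suc: "ideal_pow R I (Suc n) = ideal_prod R (ideal_pow R I n) I"
  by (simp add: nat_pow_def ideals_set_def)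

context three_generators
begin

lemma graded_cring:
  assumes "ring (G :: (nat \<Rightarrow> 'k::field fps set) ring)"
  shows "cring (G :: (nat \<Rightarrow> 'k fps set) ring)"
proof -
  interpret ring "G :: (nat \<Rightarrow> 'k fps set) ring" by fact
  have "x \<otimes>\<^bsub>G\<^esub> y = y \<otimes>\<^bsub>G\<^esub> x" if "x \<in> carrier G" "y \<in> carrier G" for x y :: "nat \<Rightarrow> 'k fps set"
    using that unfolding carrier_G by (auto simp: mult_mk conv_commute)
  then show ?thesis
    by unfold_locales auto
qed

section \<open>Retraction onto the polynomials in x\<close>

definition emb :: "'k::field poly \<Rightarrow> nat \<Rightarrow> 'k" where
  "emb p s = (if g1 dvd s then coeff p (s div g1) else 0)"

text \<open>The description operator recovers the coordinates of F, which are unique on the carrier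
  of G by \<open>mk_inject\<close>.\<close>

definition retract :: "(nat \<Rightarrow> 'k::field fps set) \<Rightarrow> 'k poly" where
  "retract F = Abs_poly (\<lambda>n. (THE c. c \<in> coords \<and> mk c = F) (n * g1))"

lemma coeff_retract:
  assumes c: "c \<in> coords" shows "coeff (retract (mk c)) n = c (n * g1)"
proof -
  have the: "(THE c'. c' \<in> coords \<and> mk c' = mk c) = c"
    using c mk_inject by blast
  have "finite {s. c s \<noteq> 0}" using c unfolding coords_def by blast
  then obtain N where N: "\<And>s. c s \<noteq> 0 \<Longrightarrow> s \<le> N"
    using finite_nat_set_iff_bounded_le by auto
  have "c (i * g1) = 0" if "N < i" for i
  proof -
    have "N < i * g1" using that g1_pos by (cases g1) auto
    then show ?thesis using N by (meson not_le)
  qed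
  then show ?thesis unfolding retract_def the by (subst coeff_Abs_poly[of N]) auto
qed

lemma emb_mult_g1: "emb p (n * g1) = coeff p n"
  unfolding emb_def using g1_pos by simp

lemma emb_nonzero: assumes "emb p s \<noteq> 0" obtains n where "s = n * g1" "coeff p n \<noteq> 0"
  using assms that[of "s div g1"] unfolding emb_def by (auto split: if_splits)

lemma emb_coords: "emb p \<in> coords"
proof -
  have "{s. emb p s \<noteq> 0} \<subseteq> (\<lambda>n. n * g1) ` {..degree p}"
    by (auto elim!: emb_nonzero intro!: le_degree)
  then have "finite {s. emb p s \<noteq> 0}" by (rule finite_subset) simp
  then show ?thesis unfolding coords_def using mult_g1_in_S by (auto elim!: emb_nonzero)
qed

text \<open>An element is at least g1 times its order, and equality for the sum forces equality for
  both summands. So powers of x arise only as products of powers of x, which makes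
  \<open>retract\<close> multiplicative.\<close>

lemma ord_add_eq_mult_g1:
  assumes "u \<in> S" "v \<in> S" "u + v = n * g1" "ord u + ord v = n"
  shows "u = ord u * g1"
proof -
  have "ord u * g1 + ord v * g1 = u + v" using assms(3,4) by (metis add_mult_distrib)
  then show ?thesis using ord_mult_le[OF assms(1)] ord_mult_le[OF assms(2)] by linarith
qed

lemma conv_mult_g1:
  fixes c d :: "nat \<Rightarrow> 'k::field"
  assumes c: "c \<in> coords" and d: "d \<in> coords"
  shows "conv c d (n * g1) = (\<Sum>i\<le>n. c (i * g1) * d ((n - i) * g1))"
proof -
  let ?t = "\<lambda>u. if ord u + ord (n * g1 - u) = ord (n * g1) then c u * d (n * g1 - u) else 0"
  have "conv c d (n * g1) = sum ?t ((\<lambda>i. i * g1) ` {..n})"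
    unfolding conv_def
  proof (rule sum.mono_neutral_right)
    show "\<forall>u\<in>{..n * g1} - (\<lambda>i. i * g1) ` {..n}. ?t u = 0"
    proof (rule ballI, rule ccontr)
      fix u assume u: "u \<in> {..n * g1} - (\<lambda>i. i * g1) ` {..n}" and nz: "?t u \<noteq> 0"
      then have o: "ord u + ord (n * g1 - u) = n" "c u \<noteq> 0" "d (n * g1 - u) \<noteq> 0"
        by (auto simp: ord_mult_g1 split: if_splits)
      have "u = ord u * g1"
        using ord_add_eq_mult_g1[OF coordsD[OF c o(2)] coordsD[OF d o(3)] _ o(1)] u by simp
      moreover have "ord u \<le> n" using o(1) by simp
      ultimately show False using u by blast
    qed
  qed auto
  also have "\<dots> = (\<Sum>i\<le>n. ?t (i * g1))"
    using g1_pos by (subst sum.reindex) (auto simp: inj_on_def)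
  also have "\<dots> = (\<Sum>i\<le>n. c (i * g1) * d ((n - i) * g1))"
    by (rule sum.cong) (auto simp: ord_mult_g1 simp flip: diff_mult_distrib)
  finally show ?thesis .
qed

lemma conv_emb: "conv (emb p) (emb q) = emb (p * q)"
proof
  fix s
  show "conv (emb p) (emb q) s = emb (p * q) s"
  proof (cases "g1 dvd s")
    case True
    then obtain n where "s = n * g1" by (metis dvdE mult.commute)
    then show ?thesis
      by (simp add: conv_mult_g1[OF emb_coords emb_coords] emb_mult_g1 coeff_mult)
  next
    case False
    have "conv (emb p) (emb q) s = 0"
    proof (rule ccontr)
      assume "conv (emb p) (emb q) s \<noteq> 0"
      then obtain u v where "s = u + v" "emb p u \<noteq> 0" "emb q v \<noteq> 0" by (rule conv_nonzero)
      then show False using False by (auto elim!: emb_nonzero)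
    qed
    then show ?thesis using False by (simp add: emb_def)
  qed
qed

text \<open>The support of c has positive defect, and defects add in nonzero products, so each
  factor raises the defect by at least 1.\<close>

lemma power_defect:
  fixes c :: "nat \<Rightarrow> 'k::field"
  assumes G: "ring (G :: (nat \<Rightarrow> 'k fps set) ring)" and c: "c \<in> coords" "\<And>n. c (n * g1) = 0"
  shows "\<exists>e\<in>coords. mk c [^]\<^bsub>G\<^esub> (N::nat) = mk e \<and> (\<forall>s. e s \<noteq> 0 \<longrightarrow> N \<le> defect s)"
proof -
  interpret ring "G :: (nat \<Rightarrow> 'k fps set) ring" by fact
  show ?thesis
  proof (induction N)
    case 0
    show ?case using coords_delta[OF zero_in_S] by (auto simp: one_mk)
  next
    case (Suc N)
    then obtain e where e: "e \<in> coords" "mk c [^]\<^bsub>G\<^esub> N = mk e" "\<And>s. e s \<noteq> 0 \<Longrightarrow> N \<le> defect s"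
      by blast
    have "Suc N \<le> defect s" if nz: "conv e c s \<noteq> 0" for s
    proof -
      obtain u v where uv: "s = u + v" "ord u + ord v = ord s" "e u \<noteq> 0" "c v \<noteq> 0"
        using nz by (rule conv_nonzero)
      have S: "u \<in> S" "v \<in> S" using uv coordsD e(1) c(1) by blast+
      have "defect v \<noteq> 0" using defect_0_iff[OF S(2)] uv(4) c(2)[of "ord v"] by auto
      then show ?thesis using defect_add[OF S] uv e(3)[OF uv(3)] by simp
    qed
    then show ?case using e c mult_mk coords_conv by (intro bexI[of _ "conv e c"]) auto
  qed
qed

text \<open>Take s of least order in the support of c and the lowest exponent i of p. Only this pair
  reaches the coefficient at \<open>s + i * g1\<close>, and absence of torsion ensures that its
  orders add.\<close>

lemma emb_regular:
  fixes c :: "nat \<Rightarrow> 'k::field"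
  assumes nt: "\<And>s. \<not> torsion s" and c: "c \<in> coords" and p: "p \<noteq> 0"
    and z: "conv (emb p) c = (\<lambda>_. 0)"
  shows "c = (\<lambda>_. 0)"
proof (rule ccontr)
  assume "c \<noteq> (\<lambda>_. 0)"
  then obtain s where s: "c s \<noteq> 0" and least: "\<And>v. c v \<noteq> 0 \<Longrightarrow> ord s \<le> ord v"
    using ex_has_least_nat[of "\<lambda>s. c s \<noteq> 0" _ ord] by blast
  define i where "i = (LEAST i. coeff p i \<noteq> 0)"
  have "\<exists>i. coeff p i \<noteq> 0" using p by (metis leading_coeff_0_iff)
  then have i: "coeff p i \<noteq> 0" unfolding i_def by (rule LeastI_ex)
  have i_le: "i \<le> n" if "coeff p n \<noteq> 0" for n unfolding i_def using that by (rule Least_le)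
  have sS: "s \<in> S" using coordsD[OF c s] .
  have os: "ord (s + i * g1) = ord s + i"
    using nt[of s] ord_add[OF sS mult_g1_in_S[of i]] sS ord_mult_g1[of i]
    unfolding torsion_def by (metis le_antisym not_le)
  have "conv (emb p) c (s + i * g1) = (\<Sum>u\<le>s + i * g1. if u = i * g1 then coeff p i * c s else 0)"
    unfolding conv_def
  proof (rule sum.cong[OF refl])
    fix u assume u: "u \<in> {..s + i * g1}"
    show "(if ord u + ord (s + i * g1 - u) = ord (s + i * g1) then emb p u * c (s + i * g1 - u) else 0)
      = (if u = i * g1 then coeff p i * c s else 0)"
    proof (cases "u = i * g1")
      case True
      then show ?thesis by (simp add: os ord_mult_g1 emb_mult_g1)
    next
      case False
      have "\<not> (ord u + ord (s + i * g1 - u) = ord (s + i * g1) \<and> emb p u \<noteq> 0 \<and> c (s + i * g1 - u) \<noteq> 0)"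
      proof
        assume a: "ord u + ord (s + i * g1 - u) = ord (s + i * g1) \<and> emb p u \<noteq> 0 \<and> c (s + i * g1 - u) \<noteq> 0"
        then obtain n where n: "u = n * g1" "coeff p n \<noteq> 0" using emb_nonzero by metis
        have "n = i" using a n(1) i_le[OF n(2)] least[of "s + i * g1 - u"] os ord_mult_g1[of n] by auto
        then show False using False n(1) by simp
      qed
      then show ?thesis using False by auto
    qed
  qed
  also have "\<dots> = coeff p i * c s" by simp
  finally show False using z i s by simp
qed

lemma cohen_macaulay_if_no_torsion:
  assumes G: "ring (G :: (nat \<Rightarrow> 'k::field fps set) ring)" and nt: "\<And>s. \<not> torsion s"
  shows "cohen_macaulay (G :: (nat \<Rightarrow> 'k fps set) ring)"
proof -
  interpret nil_retract "G :: (nat \<Rightarrow> 'k fps set) ring" retract "\<lambda>p. mk (emb p)"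
  proof (intro nil_retract.intro nil_retract_axioms.intro graded_cring[OF G])
    fix a b :: "nat \<Rightarrow> 'k fps set" assume "a \<in> carrier G" "b \<in> carrier G"
    then obtain c d where cd: "c \<in> coords" "d \<in> coords" "a = mk c" "b = mk d"
      unfolding carrier_G by blast
    show "retract (a \<oplus>\<^bsub>G\<^esub> b) = retract a + retract b"
      using cd by (simp add: poly_eq_iff add_mk coeff_retract coords_add)
    show "retract (a \<otimes>\<^bsub>G\<^esub> b) = retract a * retract b"
      using cd by (simp add: poly_eq_iff mult_mk coeff_retract coords_conv conv_mult_g1 coeff_mult)
  next
    fix p q :: "'k poly"
    show "mk (emb p) \<in> carrier G" by (rule mk_closed[OF emb_coords])
    have "emb (p + q) = (\<lambda>s. emb p s + emb q s)" by (rule ext) (simp add: emb_def)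
    then show "mk (emb (p + q)) = mk (emb p) \<oplus>\<^bsub>G\<^esub> mk (emb q)" by (simp add: add_mk)
    show "mk (emb (p * q)) = mk (emb p) \<otimes>\<^bsub>G\<^esub> mk (emb q)"
      by (simp add: mult_mk emb_coords conv_emb)
    show "retract (mk (emb p)) = p"
      by (simp add: poly_eq_iff coeff_retract emb_coords emb_mult_g1)
    have "emb (1 :: 'k poly) = delta 0"
    proof
      fix s
      show "emb (1 :: 'k poly) s = delta 0 s"
        using g1_pos by (cases "s = 0") (auto simp: emb_def delta_def elim!: dvdE)
    qed
    then show "mk (emb (1 :: 'k poly)) = \<one>\<^bsub>G\<^esub>" by (simp add: one_mk)
  next
    fix a :: "nat \<Rightarrow> 'k fps set" assume a: "a \<in> carrier G" "retract a = 0"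
    then obtain c where c: "c \<in> coords" "a = mk c" unfolding carrier_G by blast
    have "c (n * g1) = 0" for n using coeff_retract[OF c(1), of n] a(2) c(2) by simp
    \<comment> \<open>The exponent exceeds every defect by at least 1, so no coordinate
      survives.\<close>
    then obtain e where e: "e \<in> coords" "a [^]\<^bsub>G\<^esub> (Suc (2 * g1 * g3)) = mk e"
      "\<And>s. e s \<noteq> 0 \<Longrightarrow> Suc (2 * g1 * g3) \<le> defect s"
      using power_defect[OF G c(1), of "Suc (2 * g1 * g3)"] c(2) by blast
    have "e = (\<lambda>_. 0)"
    proof (rule ext, rule ccontr)
      fix s assume s: "e s \<noteq> 0"
      then show False using e(3)[OF s] defect_bound[OF coordsD[OF e(1) s]] by simp
    qed
    then show "\<exists>n::nat. a [^]\<^bsub>G\<^esub> n = \<zero>\<^bsub>G\<^esub>" using e(2) zero_mk by metis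
  next
    fix p :: "'k poly" and a :: "nat \<Rightarrow> 'k fps set"
    assume a: "p \<noteq> 0" "a \<in> carrier G" "mk (emb p) \<otimes>\<^bsub>G\<^esub> a = \<zero>\<^bsub>G\<^esub>"
    then obtain c where c: "c \<in> coords" "a = mk c" unfolding carrier_G by blast
    have "mk (conv (emb p) c) = mk (\<lambda>_. 0)"
      using a(3) unfolding c(2) mult_mk[OF emb_coords c(1)] zero_mk .
    then have "conv (emb p) c = (\<lambda>_. 0)"
      by (rule mk_inject[OF coords_conv[OF emb_coords c(1)] coords_zero])
    then have c0: "c = (\<lambda>_. 0)" by (rule emb_regular[OF nt c(1) a(1)])
    show "a = \<zero>\<^bsub>G\<^esub>" unfolding c(2) c0 zero_mk ..
  qed
  show ?thesis by (rule cohen_macaulay)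
qed

section \<open>Powers of the maximal ideal and the Buchsbaum condition\<close>

lemma MM_eq: "MM = mk ` {c \<in> coords :: (nat \<Rightarrow> 'k::field) set. c 0 = 0}"
proof -
  have "mk c 0 = mk (\<lambda>_. 0) 0 \<longleftrightarrow> c 0 = 0" for c :: "nat \<Rightarrow> 'k"
    unfolding mk_nth_eq_iff using zero_in_S ord_0 ord_pos by (metis less_irrefl)
  then show ?thesis unfolding graded_max_ideal_def carrier_G zero_mk by auto
qed

text \<open>Only 0 has order 0 in S, so each factor from \<open>MM\<close> raises the order by at
  least 1.\<close>

lemma ideal_pow_MM:
  "ideal_pow G MM k \<subseteq> mk ` {c \<in> coords :: (nat \<Rightarrow> 'k::field) set. \<forall>s. c s \<noteq> 0 \<longrightarrow> k \<le> ord s}"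
proof (induction k)
  case 0
  show ?case unfolding ideal_pow_0 carrier_G by simp
next
  case (Suc k)
  show ?case
  proof
    fix F :: "nat \<Rightarrow> 'k fps set" assume "F \<in> ideal_pow G MM (Suc k)"
    then have "F \<in> ideal_prod G (ideal_pow G MM k) MM" unfolding ideal_pow_Suc .
    then show "F \<in> mk ` {c \<in> coords. \<forall>s. c s \<noteq> 0 \<longrightarrow> Suc k \<le> ord s}"
    proof induction
      case (prod a b)
      obtain c where c: "c \<in> coords" "a = mk c" "\<And>s. c s \<noteq> 0 \<Longrightarrow> k \<le> ord s"
        using Suc prod(1) by blast
      obtain d where d: "d \<in> coords" "b = mk d" "d 0 = 0" using prod(2) MM_eq by blast
      have "Suc k \<le> ord s" if nz: "conv c d s \<noteq> 0" for s
      proof -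
        obtain u v where uv: "s = u + v" "ord u + ord v = ord s" "c u \<noteq> 0" "d v \<noteq> 0"
          using nz by (rule conv_nonzero)
        have "v \<noteq> 0" using uv(4) d(3) by metis
        then have "0 < ord v" using coordsD[OF d(1) uv(4)] ord_pos by blast
        then show ?thesis using uv(2) c(3)[OF uv(3)] by linarith
      qed
      then show ?case using c d mult_mk coords_conv by (intro image_eqI[of _ _ "conv c d"]) auto
    next
      case (sum a b)
      then obtain c d where cd: "c \<in> coords" "a = mk c" "\<And>s. c s \<noteq> 0 \<Longrightarrow> Suc k \<le> ord s"
        "d \<in> coords" "b = mk d" "\<And>s. d s \<noteq> 0 \<Longrightarrow> Suc k \<le> ord s" by blast
      have "Suc k \<le> ord s" if "c s + d s \<noteq> 0" for s
        using that cd(3)[of s] cd(6)[of s] by fastforce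
      then show ?case using cd add_mk coords_add by (intro image_eqI[of _ _ "\<lambda>s. c s + d s"]) auto
    qed
  qed
qed

text \<open>An element v of order at least \<open>n + 2 * g1\<close> contains n copies of g1, and
  these alone push the order of s + v beyond the sum of the orders.\<close>

lemma torsion_loc_cohom0:
  assumes "torsion s"
  shows "mk (delta s) \<in> loc_cohom0 G (MM :: (nat \<Rightarrow> 'k::field fps set) set)"
proof -
  obtain n where n: "s \<in> S" "ord s + n < ord (s + n * g1)" using assms unfolding torsion_def by blast
  \<comment> \<open>The successor makes the exponent visibly positive, as \<open>loc_cohom0\<close>
    requires.\<close>
  let ?k = "Suc (n + 2 * g1)"
  have "mk (delta s) \<otimes>\<^bsub>G\<^esub> F = \<zero>\<^bsub>G\<^esub>" if F: "F \<in> ideal_pow G MM ?k" for F :: "nat \<Rightarrow> 'k fps set"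
  proof -
    obtain c where c: "c \<in> coords" "F = mk c" "\<And>s. c s \<noteq> 0 \<Longrightarrow> ?k \<le> ord s"
      using F ideal_pow_MM[of ?k] by blast
    have z: "conv (delta s) c = (\<lambda>_. 0)"
    proof (rule ext, rule ccontr)
      fix w assume "conv (delta s) c w \<noteq> 0"
      then obtain u v where uv: "w = u + v" "ord u + ord v = ord w" "delta s u \<noteq> (0::'k)" "c v \<noteq> 0"
        by (rule conv_nonzero)
      have u: "u = s" using uv(3) by (auto simp: delta_def split: if_splits)
      have "n + 2 * g1 \<le> ord v" using c(3)[OF uv(4)] by simp
      then obtain v' where v': "v' \<in> S" "v = n * g1 + v'" "ord v = n + ord v'"
        using split_mult_g1 coordsD[OF c(1) uv(4)] by blast
      have "ord (s + n * g1) + ord v' \<le> ord (s + n * g1 + v')"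
        using ord_add S_add n(1) mult_g1_in_S v'(1) by blast
      then show False using n(2) uv(1,2) u v'(2,3) by (simp add: add.assoc)
    qed
    show ?thesis unfolding c(2) mult_mk[OF coords_delta[OF n(1)] c(1)] z zero_mk ..
  qed
  then have "mk (delta s) \<in> ann G (ideal_pow G (MM :: (nat \<Rightarrow> 'k fps set) set) ?k)"
    unfolding ann_def using mk_closed[OF coords_delta[OF n(1)]] by blast
  then show ?thesis unfolding loc_cohom0_def by (intro UN_I[of ?k]) auto
qed

lemma buchsbaum_prod_zero:
  assumes "buchsbaum G (MM :: (nat \<Rightarrow> 'k::field fps set) set)" "A \<in> MM" "B \<in> loc_cohom0 G MM"
  shows "A \<otimes>\<^bsub>G\<^esub> B = (\<zero>\<^bsub>G\<^esub> :: nat \<Rightarrow> 'k fps set)"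
  using assms ideal_prod.prod[OF assms(2,3), of G] unfolding buchsbaum_def by simp

text \<open>If the orders added, the product of the two monomial classes would be the nonzero class
  of their sum. This provides \<open>soc\<close> for \<open>torsion_unique\<close>.\<close>

lemma buchsbaum_torsion:
  assumes b: "buchsbaum G (MM :: (nat \<Rightarrow> 'k::field fps set) set)"
    and s: "torsion s" and u: "u \<in> S" "u \<noteq> 0"
  shows "ord (s + u) \<noteq> ord s + ord u"
proof
  assume eq: "ord (s + u) = ord s + ord u"
  have sS: "s \<in> S" using s unfolding torsion_def by blast
  have "delta u 0 = (0::'k)" using u(2) by (simp add: delta_def)
  then have "mk (delta u) \<in> (MM :: (nat \<Rightarrow> 'k fps set) set)"
    unfolding MM_eq using coords_delta[OF u(1)] by blast
  then have "mk (delta u) \<otimes>\<^bsub>G\<^esub> mk (delta s) = (\<zero>\<^bsub>G\<^esub> :: nat \<Rightarrow> 'k fps set)"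
    by (rule buchsbaum_prod_zero[OF b _ torsion_loc_cohom0[OF s]])
  then have "mk (conv (delta u) (delta s)) = mk (\<lambda>_. 0 :: 'k)"
    unfolding mult_mk[OF coords_delta[OF u(1)] coords_delta[OF sS]] zero_mk .
  then have "conv (delta u) (delta s) (s + u) = (0 :: 'k)"
    using mk_inject[OF coords_conv[OF coords_delta[OF u(1)] coords_delta[OF sS]] coords_zero] by metis
  then show False using conv_delta[of s "s + u" "delta u :: nat \<Rightarrow> 'k"] eq by (simp add: delta_def)
qed

text \<open>For r at least 1 the Buchsbaum condition makes this annihilator all of H^0. Elements of
  H^0 are killed by x, so they are supported on torsion exponents; there is only one, and H^0 is the
  K-line through its class.\<close>

theorem annihilator_eq:
  assumes b: "buchsbaum G (MM :: (nat \<Rightarrow> 'k::field fps set) set)"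
    and ncm: "\<not> cohen_macaulay (G :: (nat \<Rightarrow> 'k fps set) ring)"
    and r: "1 \<le> r"
    and k: "k = (LEAST j. g2 dvd (j + 1) * g3 \<or> (j + 1) * g3 - g1 \<in> S)"
  shows "ann G (ideal_pow G (MM :: (nat \<Rightarrow> 'k fps set) set) r) =
    cgenideal G (monomial_class R (J (Suc 0)) S (k * g3))"
proof -
  \<comment> \<open>Without a maximal ideal \<open>cohen_macaulay\<close> would hold vacuously;
    \<open>maximalideal\<close> in turn contains the ring axioms for G.\<close>
  obtain P where "maximalideal P (G :: (nat \<Rightarrow> 'k fps set) ring)"
    using ncm unfolding cohen_macaulay_def by blast
  then have ringG: "ring (G :: (nat \<Rightarrow> 'k fps set) ring)"
    by (intro ideal.axioms(2) maximalideal.axioms(1))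
  interpret cring "G :: (nat \<Rightarrow> 'k fps set) ring" by (rule graded_cring[OF ringG])
  have unique: "s = k * g3" if "torsion s" for s
    using torsion_unique[OF buchsbaum_torsion[OF b] that] k by blast
  obtain s where "torsion s" using cohen_macaulay_if_no_torsion[OF ringG] ncm by blast
  then have t: "torsion (k * g3)" using unique by metis
  then have tS: "k * g3 \<in> S" unfolding torsion_def by blast
  let ?T = "mk (delta (k * g3)) :: nat \<Rightarrow> 'k fps set"
  have Tc: "?T \<in> carrier G" by (rule mk_closed[OF coords_delta[OF tS]])
  have "ann G (ideal_pow G MM r) = {x \<otimes>\<^bsub>G\<^esub> ?T | x. x \<in> carrier G}"
  proof
    show "ann G (ideal_pow G MM r) \<subseteq> {x \<otimes>\<^bsub>G\<^esub> ?T | x. x \<in> carrier G}"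
    proof
      fix F :: "nat \<Rightarrow> 'k fps set" assume F: "F \<in> ann G (ideal_pow G MM r)"
      then obtain c where c: "c \<in> coords" "F = mk c" unfolding ann_def carrier_G by blast
      have "F \<in> loc_cohom0 G MM" unfolding loc_cohom0_def using F r by blast
      moreover have "mk (delta g1) \<in> (MM :: (nat \<Rightarrow> 'k fps set) set)"
        unfolding MM_eq using coords_delta[OF g1_in_S] g1_pos by (auto simp: delta_def)
      ultimately have "mk (delta g1) \<otimes>\<^bsub>G\<^esub> F = \<zero>\<^bsub>G\<^esub>" using buchsbaum_prod_zero[OF b] by blast
      then have "mk (conv (delta g1) c) = mk (\<lambda>_. 0)"
        unfolding c(2) mult_mk[OF coords_delta[OF g1_in_S] c(1)] zero_mk .
      then have z: "conv c (delta g1) = (\<lambda>_. 0)"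
        using mk_inject[OF coords_conv[OF coords_delta[OF g1_in_S] c(1)] coords_zero] conv_commute by metis
      \<comment> \<open>Multiplication by x moves the coefficient at s to s + g1, so distinct
        exponents do not interfere and each one in the support is torsion.\<close>
      have supp: "s = k * g3" if s: "c s \<noteq> 0" for s
      proof (rule unique)
        have sS: "s \<in> S" using coordsD[OF c(1) s] .
        have "ord s + ord g1 \<noteq> ord (s + g1)"
          using conv_delta[of g1 "s + g1" c] z s by (auto split: if_splits)
        then have "ord s + 1 < ord (s + 1 * g1)"
          using ord_add[OF sS g1_in_S] ord_g1 by simp
        then show "torsion s" unfolding torsion_def using sS by blast
      qed
      \<comment> \<open>A scalar in degree 0: the only possible nonzero coordinate of c is the one
        at \<open>k * g3\<close>.\<close>
      let ?a = "\<lambda>s. if s = 0 then c (k * g3) else 0"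
      have a: "?a \<in> coords" unfolding coords_def using zero_in_S by simp
      have "conv ?a (delta (k * g3)) = c"
      proof
        fix s
        show "conv ?a (delta (k * g3)) s = c s"
        proof (cases "k * g3 \<le> s")
          case True
          then show ?thesis using supp[of s] by (auto simp: conv_delta ord_0)
        next
          case False
          have "conv ?a (delta (k * g3)) s = 0"
          proof (rule ccontr)
            assume "conv ?a (delta (k * g3)) s \<noteq> 0"
            then obtain u v where "s = u + v" "delta (k * g3) v \<noteq> (0::'k)" by (rule conv_nonzero)
            then show False using False by (auto simp: delta_def split: if_splits)
          qed
          then show ?thesis using supp[of s] False by auto
        qed
      qed
      then have "F = mk ?a \<otimes>\<^bsub>G\<^esub> ?T" using mult_mk[OF a coords_delta[OF tS]] c(2) by simp
      then show "F \<in> {x \<otimes>\<^bsub>G\<^esub> ?T | x. x \<in> carrier G}" using mk_closed[OF a] by blast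
    qed
    show "{x \<otimes>\<^bsub>G\<^esub> ?T | x. x \<in> carrier G} \<subseteq> ann G (ideal_pow G MM r)"
    proof
      fix F :: "nat \<Rightarrow> 'k fps set" assume "F \<in> {x \<otimes>\<^bsub>G\<^esub> ?T | x. x \<in> carrier G}"
      then obtain x where x: "x \<in> carrier G" "F = x \<otimes>\<^bsub>G\<^esub> ?T" by blast
      have "F \<otimes>\<^bsub>G\<^esub> B = \<zero>\<^bsub>G\<^esub>" if B: "B \<in> ideal_pow G MM r" for B
      proof -
        obtain d where d: "d \<in> coords" "B = mk d" "\<And>s. d s \<noteq> 0 \<Longrightarrow> r \<le> ord s"
          using B ideal_pow_MM[of r] by blast
        \<comment> \<open>Since r is positive and 0 has order 0, B lies in \<open>MM\<close>
          itself.\<close>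
        have "d 0 = 0" using d(3)[of 0] r ord_0 by force
        then have "B \<in> MM" using d unfolding MM_eq by blast
        then have "B \<otimes>\<^bsub>G\<^esub> ?T = \<zero>\<^bsub>G\<^esub>"
          by (rule buchsbaum_prod_zero[OF b _ torsion_loc_cohom0[OF t]])
        moreover have "B \<in> carrier G" using d mk_closed by blast
        ultimately show ?thesis using x Tc by (simp add: m_assoc m_comm[of ?T B])
      qed
      then show "F \<in> ann G (ideal_pow G MM r)" unfolding ann_def using x Tc by simp
    qed
  qed
  then show ?thesis unfolding cgenideal_def monomial_class_mk[OF tS] .
qed

text \<open>Every exponent of order above \<open>2 * g1\<close> contains a removable g1. This
  guarantees that the least number in \<open>reduction_number\<close> satisfies its defining
  equation.\<close>

lemma reduction_exists:
  "J (Suc (2 * g1)) = fps_X ^ g1 <#\<^bsub>R\<^esub> (J (2 * g1) :: 'k::field fps set)"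
proof
  show "fps_X ^ g1 <#\<^bsub>R\<^esub> (J (2 * g1) :: 'k fps set) \<subseteq> J (Suc (2 * g1))"
    using J_mult[OF X_generators_J1(1), of _ "2 * g1"] by (auto simp: l_coset_def)
  show "J (Suc (2 * g1)) \<subseteq> fps_X ^ g1 <#\<^bsub>R\<^esub> (J (2 * g1) :: 'k fps set)"
  proof
    fix f :: "'k fps" assume f: "f \<in> J (Suc (2 * g1))"
    have split: "\<exists>v. s = g1 + v \<and> v \<in> S \<and> 2 * g1 \<le> ord v" if s: "fps_nth f s \<noteq> 0" for s
    proof -
      have "s \<in> S" "1 + 2 * g1 \<le> ord s" using J_memD[OF f s] by simp_all
      then obtain v where "v \<in> S" "s = 1 * g1 + v" "ord s = 1 + ord v" using split_mult_g1 by blast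
      then show ?thesis using \<open>1 + 2 * g1 \<le> ord s\<close> by auto
    qed
    define g where "g = Abs_fps (\<lambda>n. fps_nth f (n + g1))"
    have "g \<in> J (2 * g1)"
    proof (rule J_memI)
      fix n assume "fps_nth g n \<noteq> 0"
      then show "n \<in> S \<and> 2 * g1 \<le> ord n" using split[of "n + g1"] by (auto simp: g_def)
    qed
    moreover have "f = fps_X ^ g1 * g"
    proof (rule fps_ext)
      fix n
      show "fps_nth f n = fps_nth (fps_X ^ g1 * g) n"
        using split[of n] by (cases "g1 \<le> n") (auto simp: fps_X_power_mult_nth g_def)
    qed
    ultimately show "f \<in> fps_X ^ g1 <#\<^bsub>R\<^esub> J (2 * g1)" by (auto simp: l_coset_def)
  qed
qed

text \<open>With reduction number 0 the series \<open>fps_X ^ g2\<close> would be a multiple of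
  \<open>fps_X ^ g1\<close> in R, so g2 - g1 would lie in S; by size this leaves only multiples of
  g1 for g2.\<close>

lemma reduction_number_pos:
  assumes "\<And>a. g2 \<noteq> a * g1"
  shows "1 \<le> reduction_number R (J (Suc 0) :: 'k::field fps set) (fps_X ^ g1)"
proof (rule ccontr)
  assume "\<not> 1 \<le> reduction_number R (J (Suc 0) :: 'k fps set) (fps_X ^ g1)"
  moreover have "J (reduction_number R (J (Suc 0) :: 'k fps set) (fps_X ^ g1) + 1) =
      fps_X ^ g1 <#\<^bsub>R\<^esub> (J (reduction_number R (J (Suc 0) :: 'k fps set) (fps_X ^ g1)) :: 'k fps set)"
    unfolding reduction_number_def ideal_pow_eq
    by (rule LeastI[of _ "2 * g1"]) (use reduction_exists in simp)
  ultimately have "J (Suc 0) = fps_X ^ g1 <#\<^bsub>R\<^esub> (J 0 :: 'k fps set)" by (simp add: not_le)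
  then obtain f :: "'k fps" where f: "f \<in> J 0" "fps_X ^ g2 = fps_X ^ g1 * f"
    using X_generators_J1(2) by (auto simp: l_coset_def)
  have "fps_nth (fps_X ^ g1 * f) g2 = 1" unfolding f(2)[symmetric] by simp
  then have "fps_nth f (g2 - g1) \<noteq> 0" using g1_less_g2 by (auto simp: fps_X_power_mult_nth split: if_splits)
  then have "g2 - g1 \<in> S" using J_memD[OF f(1)] by blast
  then obtain a b c where "g2 - g1 = a * g1 + b * g2 + c * g3" unfolding S_def rep_def by blast
  then have e: "g2 = (a + 1) * g1 + b * g2 + c * g3" using g1_less_g2 by simp
  have "b = 0" using e g1_pos by (cases b) auto
  moreover have "c = 0" using e g1_pos g2_less_g3 by (cases c) auto
  ultimately show False using e assms[of "a + 1"] by simp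
qed

end

section \<open>Irredundance of minimal generators\<close>

lemma nsgen_absorb:
  assumes "nsgen A = S" "a \<in> nsgen (A - {a})" shows "nsgen (A - {a}) = S"
proof -
  have sum: "s + t \<in> nsgen B" if "s \<in> nsgen B" "t \<in> nsgen B" for s t :: nat and B
    using that(2,1) by induction (auto intro: nsgen.add simp: add.assoc[symmetric])
  have "s \<in> nsgen A" if "s \<in> nsgen (A - {a})" for s
    using that by induction (auto intro: nsgen.intros)
  moreover have "s \<in> nsgen (A - {a})" if "s \<in> nsgen A" for s
    using that
  proof induction
    case (add s b)
    have "b \<in> nsgen (A - {a})"
      using assms(2) add.hyps(2) nsgen.add[OF nsgen.zero, of b "A - {a}"] by (cases "b = a") auto
    then show ?case using add.IH sum by blast
  qed (rule nsgen.zero)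
  ultimately show ?thesis using assms(1) by blast
qed

lemma minimal_generators_irredundant:
  assumes "minimal_generators S A" "a \<in> A" shows "a \<notin> nsgen (A - {a})"
proof
  assume "a \<in> nsgen (A - {a})"
  moreover have "nsgen A = S" using assms(1) unfolding minimal_generators_def by blast
  ultimately have "nsgen (A - {a}) = S" by (intro nsgen_absorb)
  moreover have "A - {a} \<subset> A" using assms(2) by blast
  ultimately show False using assms(1) unfolding minimal_generators_def by blast
qed

lemma mult_in_nsgen: "a \<in> A \<Longrightarrow> n * a \<in> nsgen A"
proof (induction n)
  case (Suc n)
  then show ?case using nsgen.add[of "n * a" A a] by (simp add: add.commute)
qed (simp add: nsgen.zero)

theorem corollary4p4:
  fixes g1 g2 g3 r k :: nat
    and S :: "nat set"
    and R :: "('k::field) fps ring"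
    and m :: "'k fps set"
    and G :: "(nat \<Rightarrow> 'k fps set) ring"
    and MM :: "(nat \<Rightarrow> 'k fps set) set"
  assumes "infinite (UNIV :: 'k set)"
    and "g1 < g2" and "g2 < g3" and "Gcd {g1, g2, g3} = 1"
    and "minimal_generators S {g1, g2, g3}"
    and "R = semigroup_ring S"
    and "m = genideal R {fps_X ^ g1, fps_X ^ g2, fps_X ^ g3}"
    and "G = assoc_graded R m"
    and "MM = graded_max_ideal R m"
    and "r = reduction_number R m (fps_X ^ g1)"
    and "k = (LEAST j. g2 dvd (j + 1) * g3 \<or> (j + 1) * g3 - g1 \<in> S)"
    and "buchsbaum G MM"
    and "\<not> cohen_macaulay G"
  shows "ann G (ideal_pow G MM r) = cgenideal G (monomial_class R m S (k * g3))"
proof -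
  note irredundant = minimal_generators_irredundant[OF assms(5)]
  \<comment> \<open>The element 0 lies in every generated semigroup, so it is never
    irredundant.\<close>
  have "g1 \<noteq> 0"
  proof
    assume "g1 = 0"
    then show False using irredundant[of g1] nsgen.zero[of "{g1, g2, g3} - {g1}"] by simp
  qed
  then interpret T: three_generators g1 g2 g3
    using assms(2,3) by unfold_locales auto
  have S: "S = T.S" using assms(5) T.nsgen_eq_S unfolding minimal_generators_def by simp
  have m: "m = T.J (Suc 0)" using assms(6,7) S T.maximal_ideal_eq by simp
  have "g2 \<noteq> a * g1" for a
    using irredundant[of g2] mult_in_nsgen[of g1 "{g1, g2, g3} - {g2}" a] assms(2) by auto
  then have "1 \<le> r" using T.reduction_number_pos assms(6,10) S m by simp
  then show ?thesis
    using T.annihilator_eq assms(6,8,9,11,12,13) S m by blast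
qed

end
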